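(* Let $f:[0,\infty)\to\mathbb{R}$ and $h:(0,\infty)\to\mathbb{R}$ be continuous functions with $h>0$. Let $\Pi_{f\Delta h}(A,B)=h(A)^{1/2}f\big(h(A)^{-1/2}Bh(A)^{-1/2}\big)h(A)^{1/2}$ be the generalized perspective of $f$ and $h$, for $A$ strictly positive and $B$ positive. (i) If $f$ is operator convex, $h$ is operator concave and $f(0)\le 0$, then $\Pi_{f\Delta h}$ is jointly convex. (ii) If $f$ and $h$ are operator concave and $f(0)\ge 0$, then $\Pi_{f\Delta h}$ is jointly concave. (iii) If $\Pi_{f\Delta h}$ is jointly convex (respectively, jointly concave), then $f$ is operator convex (respectively, operator concave). (iv) If $f(0)>0$ and $\Pi_{f\Delta h}$ is jointly convex (respectively, jointly concave), then $h$ is operator convex (respectively, operator concave). (v) If $f(0)<0$ and $\Pi_{f\Delta h}$ is jointly convex (respectively, jointly concave), then $h$ is operator concave (respectively, operator convex).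
   Context: $\mathcal H$ is an infinite-dimensional separable Hilbert space, and all operators are bounded linear operators on $\mathcal H$. An operator is strictly positive if it is positive and invertible. $\le$ is the usual order on self-adjoint operators, and $f(A)$ is defined by continuous functional calculus. A continuous real function $f$ on an interval $I$ is operator convex if $f(cA_1+(1-c)A_2)\le cf(A_1)+(1-c)f(A_2)$ for all self-adjoint $A_1,A_2$ with spectra in $I$ and all $c\in[0,1]$; it is operator concave if $-f$ is operator convex. A function $g(A,B)$ of two operator variables with self-adjoint values is jointly convex if $g(cA_1+(1-c)A_2,cB_1+(1-c)B_2)\le cg(A_1,B_1)+(1-c)g(A_2,B_2)$ for all $(A_1,B_1),(A_2,B_2)$ in its domain and all $c\in[0,1]$, and jointly concave if the reverse inequality always holds. *)

theory Defs
  imports "HOL-Analysis.Analysis" "HOL-Computational_Algebra.Polynomial"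
begin

section \<open>Complex Hilbert spaces\<close>

text \<open>The inner product \<open>cinner\<close> is linear in its first argument. The real inner product of
  the superclass is not additional structure: it is required to be the real part of \<open>cinner\<close>, so
  that the norm is \<open>sqrt (Re (cinner x x))\<close>.\<close>

class complex_hilbert = real_inner + complete_space +
  fixes scaleC :: "complex \<Rightarrow> 'a \<Rightarrow> 'a"  (infixr "*\<^sub>C" 75)
    and cinner :: "'a \<Rightarrow> 'a \<Rightarrow> complex"
  assumes scaleC_of_real: "complex_of_real r *\<^sub>C x = r *\<^sub>R x"
    and scaleC_add_right: "a *\<^sub>C (x + y) = a *\<^sub>C x + a *\<^sub>C y"
    and scaleC_add_left: "(a + b) *\<^sub>C x = a *\<^sub>C x + b *\<^sub>C x"
    and scaleC_scaleC: "a *\<^sub>C b *\<^sub>C x = (a * b) *\<^sub>C x"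
    and scaleC_one: "1 *\<^sub>C x = x"
    and cinner_commute: "cinner x y = cnj (cinner y x)"
    and cinner_add_left: "cinner (x + y) z = cinner x z + cinner y z"
    and cinner_scaleC_left: "cinner (a *\<^sub>C x) y = a * cinner x y"
    and inner_eq_Re_cinner: "inner x y = Re (cinner x y)"
begin

subclass banach ..

end

global_interpretation complex_vector:
  vector_space "scaleC :: complex \<Rightarrow> 'a \<Rightarrow> 'a::complex_hilbert"
  by unfold_locales
    (rule scaleC_add_right scaleC_add_left scaleC_scaleC scaleC_one)+

definition infinite_dimensional :: "'a::complex_hilbert itself \<Rightarrow> bool" where
  "infinite_dimensional _ \<longleftrightarrow>
     (\<forall>B::'a set. finite B \<longrightarrow> module.span scaleC B \<noteq> (UNIV :: 'a set))"

lemma cinner_scaleC_right: "cinner x (a *\<^sub>C y) = cnj a * cinner x y"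
  by (metis cinner_commute cinner_scaleC_left complex_cnj_mult)

lemma norm_scaleC: "norm (a *\<^sub>C x) = cmod a * norm (x::'a::complex_hilbert)"
proof -
  have "cinner (a *\<^sub>C x) (a *\<^sub>C x) = complex_of_real ((cmod a)\<^sup>2) * cinner x x"
    by (simp add: cinner_scaleC_left cinner_scaleC_right complex_norm_square mult.assoc del: of_real_power)
  then have "inner (a *\<^sub>C x) (a *\<^sub>C x) = (cmod a)\<^sup>2 * inner x x"
    by (simp add: inner_eq_Re_cinner del: of_real_power)
  then show ?thesis
    by (simp add: norm_eq_sqrt_inner real_sqrt_mult)
qed

lemma bounded_linear_scaleC: "bounded_linear (\<lambda>x::'a::complex_hilbert. a *\<^sub>C x)"
proof (rule bounded_linear_intro[where K = "cmod a"])
  show "a *\<^sub>C (r *\<^sub>R x) = r *\<^sub>R (a *\<^sub>C x)" for r and x :: 'a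
    by (simp add: scaleC_of_real[symmetric] scaleC_scaleC mult.commute)
qed (simp_all add: scaleC_add_right norm_scaleC mult.commute)


section \<open>Bounded operators\<close>

text \<open>Elements of \<^typ>\<open>'a \<Rightarrow>\<^sub>L 'a\<close> are only real-linear; the bounded operators on the complex Hilbert
  space are those satisfying \<open>clinear_op\<close>.\<close>

definition clinear_op :: "('a::complex_hilbert \<Rightarrow>\<^sub>L 'a) \<Rightarrow> bool" where
  "clinear_op A \<longleftrightarrow> (\<forall>c x. A (c *\<^sub>C x) = c *\<^sub>C A x)"

lift_definition scalar_op :: "complex \<Rightarrow> ('a::complex_hilbert \<Rightarrow>\<^sub>L 'a)" is "\<lambda>c x. c *\<^sub>C x"
  by (rule bounded_linear_scaleC)

definition invertible_op :: "('a::complex_hilbert \<Rightarrow>\<^sub>L 'a) \<Rightarrow> bool" where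
  "invertible_op A \<longleftrightarrow>
     (\<exists>S. clinear_op S \<and> A o\<^sub>L S = id_blinfun \<and> S o\<^sub>L A = id_blinfun)"

definition spectrum :: "('a::complex_hilbert \<Rightarrow>\<^sub>L 'a) \<Rightarrow> complex set" where
  "spectrum A = {z. \<not> invertible_op (A - scalar_op z)}"

definition selfadjoint_op :: "('a::complex_hilbert \<Rightarrow>\<^sub>L 'a) \<Rightarrow> bool" where
  "selfadjoint_op A \<longleftrightarrow> clinear_op A \<and> (\<forall>x y. cinner (A x) y = cinner x (A y))"

definition positive_op :: "('a::complex_hilbert \<Rightarrow>\<^sub>L 'a) \<Rightarrow> bool" where
  "positive_op A \<longleftrightarrow> selfadjoint_op A \<and> (\<forall>x. 0 \<le> Re (cinner (A x) x))"

definition strictly_positive_op :: "('a::complex_hilbert \<Rightarrow>\<^sub>L 'a) \<Rightarrow> bool" where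
  "strictly_positive_op A \<longleftrightarrow> positive_op A \<and> invertible_op A"

definition op_le :: "('a::complex_hilbert \<Rightarrow>\<^sub>L 'a) \<Rightarrow> ('a \<Rightarrow>\<^sub>L 'a) \<Rightarrow> bool"  (infix "\<preceq>" 50) where
  "A \<preceq> B \<longleftrightarrow> selfadjoint_op A \<and> selfadjoint_op B \<and> positive_op (B - A)"


section \<open>Continuous functional calculus\<close>

definition op_power :: "('a::complex_hilbert \<Rightarrow>\<^sub>L 'a) \<Rightarrow> nat \<Rightarrow> ('a \<Rightarrow>\<^sub>L 'a)" where
  "op_power A n = ((\<lambda>T. A o\<^sub>L T) ^^ n) id_blinfun"

definition poly_op :: "real poly \<Rightarrow> ('a::complex_hilbert \<Rightarrow>\<^sub>L 'a) \<Rightarrow> ('a \<Rightarrow>\<^sub>L 'a)" where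
  "poly_op p A = (\<Sum>i\<le>degree p. coeff p i *\<^sub>R op_power A i)"

text \<open>For self-adjoint \<open>A\<close> (whose spectrum is real) and \<open>f\<close> continuous on the spectrum,
  \<open>f(A)\<close> is the operator-norm limit of \<open>p\<^sub>n(A)\<close> for any polynomials \<open>p\<^sub>n\<close> converging to \<open>f\<close>
  uniformly on the spectrum. Only the values of \<open>f\<close> on the spectrum matter, so functions on an
  interval are represented by total functions with arbitrary values outside it.\<close>

definition cfc :: "(real \<Rightarrow> real) \<Rightarrow> ('a::complex_hilbert \<Rightarrow>\<^sub>L 'a) \<Rightarrow> ('a \<Rightarrow>\<^sub>L 'a)" where
  "cfc f A = (THE T. \<exists>p :: nat \<Rightarrow> real poly.
     uniform_limit {t. complex_of_real t \<in> spectrum A} (\<lambda>n. poly (p n)) f sequentially \<and>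
     (\<lambda>n. poly_op (p n) A) \<longlonglongrightarrow> T)"

definition op_powr :: "('a::complex_hilbert \<Rightarrow>\<^sub>L 'a) \<Rightarrow> real \<Rightarrow> ('a \<Rightarrow>\<^sub>L 'a)" where
  "op_powr A r = cfc (\<lambda>t. t powr r) A"


section \<open>Operator convexity\<close>

text \<open>The type argument is the Hilbert space on which the operators act.\<close>

definition operator_convex :: "'a::complex_hilbert itself \<Rightarrow> real set \<Rightarrow> (real \<Rightarrow> real) \<Rightarrow> bool" where
  "operator_convex _ I f \<longleftrightarrow> continuous_on I f \<and>
     (\<forall>(A\<^sub>1 :: 'a \<Rightarrow>\<^sub>L 'a) A\<^sub>2. \<forall>c\<in>{0..1}.
        selfadjoint_op A\<^sub>1 \<and> spectrum A\<^sub>1 \<subseteq> complex_of_real ` I \<and>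
        selfadjoint_op A\<^sub>2 \<and> spectrum A\<^sub>2 \<subseteq> complex_of_real ` I \<longrightarrow>
        cfc f (c *\<^sub>R A\<^sub>1 + (1 - c) *\<^sub>R A\<^sub>2) \<preceq> c *\<^sub>R cfc f A\<^sub>1 + (1 - c) *\<^sub>R cfc f A\<^sub>2)"

definition operator_concave :: "'a::complex_hilbert itself \<Rightarrow> real set \<Rightarrow> (real \<Rightarrow> real) \<Rightarrow> bool" where
  "operator_concave H I f \<longleftrightarrow> operator_convex H I (\<lambda>t. - f t)"

definition jointly_convex_on ::
  "(('a::complex_hilbert \<Rightarrow>\<^sub>L 'a) \<times> ('a \<Rightarrow>\<^sub>L 'a)) set \<Rightarrow>
   (('a \<Rightarrow>\<^sub>L 'a) \<Rightarrow> ('a \<Rightarrow>\<^sub>L 'a) \<Rightarrow> ('a \<Rightarrow>\<^sub>L 'a)) \<Rightarrow> bool" where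
  "jointly_convex_on D g \<longleftrightarrow>
     (\<forall>(A\<^sub>1, B\<^sub>1)\<in>D. \<forall>(A\<^sub>2, B\<^sub>2)\<in>D. \<forall>c\<in>{0..1}.
        g (c *\<^sub>R A\<^sub>1 + (1 - c) *\<^sub>R A\<^sub>2) (c *\<^sub>R B\<^sub>1 + (1 - c) *\<^sub>R B\<^sub>2)
          \<preceq> c *\<^sub>R g A\<^sub>1 B\<^sub>1 + (1 - c) *\<^sub>R g A\<^sub>2 B\<^sub>2)"

definition jointly_concave_on ::
  "(('a::complex_hilbert \<Rightarrow>\<^sub>L 'a) \<times> ('a \<Rightarrow>\<^sub>L 'a)) set \<Rightarrow>
   (('a \<Rightarrow>\<^sub>L 'a) \<Rightarrow> ('a \<Rightarrow>\<^sub>L 'a) \<Rightarrow> ('a \<Rightarrow>\<^sub>L 'a)) \<Rightarrow> bool" where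
  "jointly_concave_on D g \<longleftrightarrow>
     (\<forall>(A\<^sub>1, B\<^sub>1)\<in>D. \<forall>(A\<^sub>2, B\<^sub>2)\<in>D. \<forall>c\<in>{0..1}.
        c *\<^sub>R g A\<^sub>1 B\<^sub>1 + (1 - c) *\<^sub>R g A\<^sub>2 B\<^sub>2
          \<preceq> g (c *\<^sub>R A\<^sub>1 + (1 - c) *\<^sub>R A\<^sub>2) (c *\<^sub>R B\<^sub>1 + (1 - c) *\<^sub>R B\<^sub>2))"


section \<open>Generalized perspectives\<close>

definition perspective_domain ::
  "'a::complex_hilbert itself \<Rightarrow> (('a \<Rightarrow>\<^sub>L 'a) \<times> ('a \<Rightarrow>\<^sub>L 'a)) set" where
  "perspective_domain _ = {(A, B). strictly_positive_op A \<and> positive_op B}"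

definition gen_perspective ::
  "(real \<Rightarrow> real) \<Rightarrow> (real \<Rightarrow> real) \<Rightarrow>
   ('a::complex_hilbert \<Rightarrow>\<^sub>L 'a) \<Rightarrow> ('a \<Rightarrow>\<^sub>L 'a) \<Rightarrow> ('a \<Rightarrow>\<^sub>L 'a)" where
  "gen_perspective f h A B =
     op_powr (cfc h A) (1/2)
     o\<^sub>L cfc f (op_powr (cfc h A) (- (1/2)) o\<^sub>L B o\<^sub>L op_powr (cfc h A) (- (1/2)))
     o\<^sub>L op_powr (cfc h A) (1/2)"

end

theory Submission
  imports Defs "HOL-Computational_Algebra.Fundamental_Theorem_Algebra"
begin

text \<open>Positive scalars commute with everything, so the necessity parts come from evaluating the
  perspective at special arguments. At \<open>A = 1\<close>, \<open>B = h(1) X\<close> it equals \<open>h(1) f(X)\<close>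
  (\<open>gen_perspective_id\<close>), which transfers joint convexity to \<open>f\<close>; at \<open>B = 0\<close> it equals \<open>f(0) h(A)\<close>
  (\<open>gen_perspective_zero\<close>), which transfers it to \<open>h\<close> or to \<open>- h\<close> according to the sign of \<open>f(0)\<close>.
  Every statement about joint concavity is the one about joint convexity for \<open>- f\<close>.

  For sufficiency let \<open>S = h(c A1 + (1 - c) A2)\<close> and
  \<open>Ti = sqrt ci h(Ai)^(1/2) S^(-1/2)\<close> with \<open>c1 = c\<close>, \<open>c2 = 1 - c\<close>. Operator concavity of \<open>h\<close> says
  precisely that \<open>T1* T1 + T2* T2 \<le> 1\<close>, and the argument
  \<open>S^(-1/2) (c B1 + (1 - c) B2) S^(-1/2)\<close> of \<open>f\<close> is \<open>T1* X1 T1 + T2* X2 T2\<close> with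
  \<open>Xi = h(Ai)^(-1/2) Bi h(Ai)^(-1/2)\<close>. The claim is then the operator inequality of Jensen type
  \<open>f(T1* X1 T1 + T2* X2 T2) \<le> T1* f(X1) T1 + T2* f(X2) T2\<close>, valid for operator convex \<open>f\<close> with
  \<open>f(0) \<le> 0\<close>, multiplied by \<open>S^(1/2)\<close> on both sides (\<open>operator_convex_jensen\<close>,
  \<open>jointly_convex_gen_perspective\<close>).

  The Jensen inequality is proved inside the given space: an infinite-dimensional Hilbert space
  contains mutually orthogonal copies of itself (\<open>exists_orthogonal_isometries\<close>), so the block
  operators of the usual dilation argument act on the space itself. The contractive column
  \<open>(T1, T2)\<close> is completed to an isometry \<open>W\<close> by its defect operator, and for isometries the
  inequality \<open>f(W* X W) \<le> W* f(X) W\<close> follows from convexity at \<open>X\<close> and \<open>U X U\<close> with the symmetry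
  \<open>U = 2 W W* - 1\<close> (\<open>operator_convex_compression\<close>). Functional calculus is handled throughout by
  the rule that \<open>A W = W B\<close> implies \<open>f(A) W = W f(B)\<close> (\<open>cfc_intertwine\<close>).

  The functional calculus rests on the inequality \<open>norm (p(A)) \<le> sup |p|\<close> over the spectrum
  (\<open>norm_poly_op_le\<close>). It follows from positivity of \<open>p(A)\<close> for \<open>p \<ge> 0\<close> on the spectrum, which in
  turn uses that the infimum of the numerical range of a self-adjoint operator belongs to the
  spectrum (\<open>lower_bound_in_real_spectrum\<close>) and the factorization of real polynomials into linear
  and definite quadratic factors (\<open>poly_op_bounded_below\<close>). Only the real part of the inner
  product enters: a complex-linear operator is self-adjoint as soon as it is symmetric for the real
  inner product (\<open>selfadjoint_op_iff\<close>).\<close>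

section \<open>Self-adjoint operators and invertibility\<close>

lemma scaleC_zero_right [simp]: "a *\<^sub>C (0::'a::complex_hilbert) = 0"
  using bounded_linear.linear[OF bounded_linear_scaleC] linear_0 by blast

lemma Im_cinner: "Im (cinner x y) = inner x (\<i> *\<^sub>C (y::'a::complex_hilbert))"
  by (simp add: inner_eq_Re_cinner cinner_scaleC_right)

lemma selfadjoint_op_iff:
  "selfadjoint_op A \<longleftrightarrow> clinear_op A \<and> (\<forall>x y. inner (A x) y = inner x (A y))"
proof (cases "clinear_op A")
  case True
  have "cinner (A x) y = cinner x (A y)" if "\<forall>x y. inner (A x) y = inner x (A y)" for x y
  proof (rule complex_eqI)
    show "Re (cinner (A x) y) = Re (cinner x (A y))"
      using that by (simp add: inner_eq_Re_cinner)
    show "Im (cinner (A x) y) = Im (cinner x (A y))"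
      using that True by (simp add: Im_cinner clinear_op_def)
  qed
  then show ?thesis
    by (auto simp: selfadjoint_op_def inner_eq_Re_cinner)
qed (simp add: selfadjoint_op_def)

lemma positive_op_iff: "positive_op A \<longleftrightarrow> selfadjoint_op A \<and> (\<forall>x. 0 \<le> inner (A x) x)"
  by (simp add: positive_op_def inner_eq_Re_cinner)

lemma selfadjoint_inner: "selfadjoint_op A \<Longrightarrow> inner (A x) y = inner x (A y)"
  by (simp add: selfadjoint_op_iff)

lemma op_le_iff:
  "A \<preceq> B \<longleftrightarrow> selfadjoint_op A \<and> selfadjoint_op B \<and> (\<forall>x. inner (A x) x \<le> inner (B x) x)"
  by (auto simp: op_le_def positive_op_iff selfadjoint_op_iff clinear_op_def blinfun.diff_left
      inner_diff_left inner_diff_right bounded_linear.linear[OF bounded_linear_scaleC] linear_diff)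

lemma clinear_op_commute: "clinear_op A \<Longrightarrow> A (c *\<^sub>C x) = c *\<^sub>C A x"
  by (simp add: clinear_op_def)

lemma clinear_op_id [simp]: "clinear_op id_blinfun"
  by (simp add: clinear_op_def)

lemma clinear_op_zero [simp]: "clinear_op 0"
  by (simp add: clinear_op_def)

lemma clinear_op_add [simp]: "clinear_op A \<Longrightarrow> clinear_op B \<Longrightarrow> clinear_op (A + B)"
  by (simp add: clinear_op_def blinfun.add_left scaleC_add_right)

lemma scaleC_diff_right: "a *\<^sub>C (x - y) = a *\<^sub>C x - a *\<^sub>C (y::'a::complex_hilbert)"
  using bounded_linear.linear[OF bounded_linear_scaleC] linear_diff by blast

lemma scaleC_scaleR: "a *\<^sub>C (r *\<^sub>R x) = r *\<^sub>R (a *\<^sub>C (x::'a::complex_hilbert))"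
  by (simp add: scaleC_of_real[symmetric] scaleC_scaleC mult.commute)

lemma clinear_op_diff [simp]: "clinear_op A \<Longrightarrow> clinear_op B \<Longrightarrow> clinear_op (A - B)"
  by (simp add: clinear_op_def blinfun.diff_left scaleC_diff_right)

lemma clinear_op_scaleR [simp]: "clinear_op A \<Longrightarrow> clinear_op (r *\<^sub>R A)"
  by (simp add: clinear_op_def blinfun.scaleR_left scaleC_scaleR)

lemma clinear_op_compose [simp]: "clinear_op A \<Longrightarrow> clinear_op B \<Longrightarrow> clinear_op (A o\<^sub>L B)"
  by (simp add: clinear_op_def)

lemma clinear_op_scalar_op [simp]: "clinear_op (scalar_op z)"
  by (simp add: clinear_op_def scalar_op.rep_eq scaleC_scaleC mult.commute)

lemma selfadjoint_clinear: "selfadjoint_op A \<Longrightarrow> clinear_op A"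
  by (simp add: selfadjoint_op_iff)

lemma selfadjoint_op_zero [simp]: "selfadjoint_op 0"
  by (simp add: selfadjoint_op_iff)

lemma selfadjoint_op_id [simp]: "selfadjoint_op id_blinfun"
  by (simp add: selfadjoint_op_iff)

lemma selfadjoint_op_add [simp]: "selfadjoint_op A \<Longrightarrow> selfadjoint_op B \<Longrightarrow> selfadjoint_op (A + B)"
  by (simp add: selfadjoint_op_iff blinfun.add_left inner_add_left inner_add_right)

lemma selfadjoint_op_diff [simp]: "selfadjoint_op A \<Longrightarrow> selfadjoint_op B \<Longrightarrow> selfadjoint_op (A - B)"
  by (simp add: selfadjoint_op_iff blinfun.diff_left inner_diff_left inner_diff_right)

lemma selfadjoint_op_scaleR [simp]: "selfadjoint_op A \<Longrightarrow> selfadjoint_op (r *\<^sub>R A)"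
  by (simp add: selfadjoint_op_iff blinfun.scaleR_left)

lemma op_le_uminus_iff: "- A \<preceq> - B \<longleftrightarrow> B \<preceq> A"
proof -
  have "selfadjoint_op (- T) \<longleftrightarrow> selfadjoint_op T" for T :: "'a \<Rightarrow>\<^sub>L 'a"
    using selfadjoint_op_scaleR[of T "-1"] selfadjoint_op_scaleR[of "- T" "-1"] by auto
  then show ?thesis
    by (auto simp: op_le_iff blinfun.minus_left)
qed

lemma op_le_scaleR_iff:
  assumes "k > 0"
  shows "k *\<^sub>R A \<preceq> k *\<^sub>R B \<longleftrightarrow> A \<preceq> B"
proof -
  have "selfadjoint_op (k *\<^sub>R T) \<longleftrightarrow> selfadjoint_op T" for T :: "'a \<Rightarrow>\<^sub>L 'a"
    using selfadjoint_op_scaleR[of T k] selfadjoint_op_scaleR[of "k *\<^sub>R T" "1 / k"] assms by auto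
  then show ?thesis
    using assms by (simp add: op_le_iff blinfun.scaleR_left)
qed

lemma selfadjoint_op_conjugate:
  assumes "selfadjoint_op A" "clinear_op W" "clinear_op W'"
    and "\<And>x y. inner (W x) y = inner x (W' y)"
  shows "selfadjoint_op (W' o\<^sub>L A o\<^sub>L W)"
  using assms by (simp add: selfadjoint_op_iff) (metis inner_commute)

lemma positive_op_conjugate:
  assumes "positive_op A" "clinear_op W" "clinear_op W'"
    and "\<And>x y. inner (W x) y = inner x (W' y)"
  shows "positive_op (W' o\<^sub>L A o\<^sub>L W)"
  using assms selfadjoint_op_conjugate[OF _ assms(2,3,4)]
  by (simp add: positive_op_iff) (metis inner_commute)

lemma compose_id_blinfun: "(A o\<^sub>L id_blinfun) = A"
  by (rule blinfun_eqI) simp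

lemma positive_op_selfadjoint: "positive_op A \<Longrightarrow> selfadjoint_op A"
  by (simp add: positive_op_iff)

lemma positive_op_add: "positive_op A \<Longrightarrow> positive_op B \<Longrightarrow> positive_op (A + B)"
  by (simp add: positive_op_iff blinfun.add_left inner_add_left)

lemma positive_op_scaleR: "positive_op A \<Longrightarrow> 0 \<le> r \<Longrightarrow> positive_op (r *\<^sub>R A)"
  by (simp add: positive_op_iff blinfun.scaleR_left)

lemma selfadjoint_op_square [simp]: "selfadjoint_op A \<Longrightarrow> selfadjoint_op (A o\<^sub>L A)"
  by (simp add: selfadjoint_op_iff)

text \<open>This is the Cauchy--Schwarz inequality for the form \<open>inner (B x) y\<close>, applied to the pair
  \<open>(x, B x)\<close>; it comes from evaluating the form at \<open>x - (1/K) B x\<close>.\<close>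

lemma positive_form_norm_bound:
  assumes B: "positive_op B" and K: "K > 0" "\<And>x. inner (B x) x \<le> K * (norm x)\<^sup>2"
  shows "(norm (B x))\<^sup>2 \<le> K * inner (B x) x"
proof -
  have sym: "inner (B u) v = inner u (B v)" for u v
    using B by (simp add: positive_op_iff selfadjoint_inner)
  define s where "s = 1 / K"
  have "0 \<le> inner (B (x - s *\<^sub>R B x)) (x - s *\<^sub>R B x)"
    using B by (simp add: positive_op_iff)
  also have "\<dots> = inner (B x) x - 2 * s * (norm (B x))\<^sup>2 + s\<^sup>2 * inner (B (B x)) (B x)"
    using sym[of "B x" x]
    by (simp add: blinfun.diff_right blinfun.scaleR_right inner_diff_left inner_diff_right
        power2_norm_eq_inner algebra_simps) (simp add: power2_eq_square)
  also have "\<dots> \<le> inner (B x) x - 2 * s * (norm (B x))\<^sup>2 + s\<^sup>2 * (K * (norm (B x))\<^sup>2)"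
    using K(2)[of "B x"] by (simp add: mult_left_mono)
  also have "\<dots> = inner (B x) x - (norm (B x))\<^sup>2 / K"
    using K(1) by (simp add: s_def field_simps power2_eq_square)
  finally show ?thesis
    using K(1) by (simp add: field_simps)
qed

lemma inner_le_norm_op:
  fixes B :: "'a::complex_hilbert \<Rightarrow>\<^sub>L 'a"
  shows "inner (B x) x \<le> norm B * (norm x)\<^sup>2"
proof -
  have "inner (B x) x \<le> norm (B x) * norm x"
    by (rule norm_cauchy_schwarz)
  also have "\<dots> \<le> norm B * norm x * norm x"
    by (simp add: mult_right_mono norm_blinfun)
  finally show ?thesis
    by (simp add: power2_eq_square mult.assoc)
qed

text \<open>For self-adjoint operators this is invertibility, but it passes to products without any
  commutation and is visibly stable under small perturbations.\<close>

definition bounded_below :: "('a::complex_hilbert \<Rightarrow>\<^sub>L 'a) \<Rightarrow> bool" where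
  "bounded_below A \<longleftrightarrow> (\<exists>d>0. \<forall>x. d * norm x \<le> norm (A x))"

lemma bounded_below_compose:
  assumes "bounded_below A" "bounded_below B"
  shows "bounded_below (A o\<^sub>L B)"
proof -
  obtain d e where d: "d > 0" "\<And>x. d * norm x \<le> norm (A x)"
    and e: "e > 0" "\<And>x. e * norm x \<le> norm (B x)"
    using assms by (auto simp: bounded_below_def)
  have "d * e * norm x \<le> norm (A (B x))" for x
    using order_trans[OF mult_left_mono[OF e(2)] d(2)[of "B x"]] d(1) by (simp add: mult.assoc)
  then show ?thesis
    using d(1) e(1) by (auto simp: bounded_below_def intro!: exI[of _ "d * e"])
qed

lemma coercive_bounded_below:
  assumes "e > 0" "\<And>x. e * (norm x)\<^sup>2 \<le> inner (B x) x"
  shows "e * norm x \<le> norm (B x)"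
proof (cases "x = 0")
  case False
  have "e * norm x * norm x \<le> norm (B x) * norm x"
    using assms(2)[of x] norm_cauchy_schwarz[of "B x" x]
    by (simp add: power2_eq_square mult.assoc)
  then show ?thesis
    using False by simp
qed simp

text \<open>Solving \<open>B x = y\<close> amounts to finding a fixed point of \<open>x - (1/K) (B x - y)\<close>, and this map is
  a contraction once \<open>K\<close> exceeds the norm of \<open>B\<close>. The invertibility results about spectra below
  reduce to this one after multiplication with a commuting operator that makes the product
  coercive.\<close>

lemma coercive_invertible:
  assumes B: "selfadjoint_op B" and e: "e > 0" "\<And>x. e * (norm x)\<^sup>2 \<le> inner (B x) x"
  shows "invertible_op B"
proof -
  \<comment> \<open>the summand \<open>2 * e\<close>, rather than \<open>e\<close>, keeps the contraction constant \<open>c\<close> positive\<close>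
  define K where "K = norm B + 2 * e"
  define c where "c = 1 - e / K"
  have K: "K > e" "K > 0"
    using e(1) norm_ge_zero[of B] by (auto simp: K_def simp del: norm_ge_zero)
  have c: "0 < c" "c < 1"
    using K e(1) by (auto simp: c_def field_simps)
  define D where "D = id_blinfun - (1 / K) *\<^sub>R B"
  have D_inner: "inner (D x) x = (norm x)\<^sup>2 - inner (B x) x / K" for x
    by (simp add: D_def blinfun.diff_left blinfun.scaleR_left inner_diff_left power2_norm_eq_inner)
  have "inner (B x) x \<le> K * (norm x)\<^sup>2" for x
    using inner_le_norm_op[of B x] e(1) by (simp add: K_def algebra_simps)
       (smt (verit) zero_le_power2 mult_nonneg_nonneg)
  then have "0 \<le> inner (D x) x" for x
    using K by (simp add: D_inner field_simps)
  then have Dpos: "positive_op D"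
    using B by (simp add: positive_op_iff D_def)
  have Dle: "inner (D x) x \<le> c * (norm x)\<^sup>2" for x
    using e(2)[of x] K by (simp add: D_inner c_def field_simps)
  have contr: "norm (D x) \<le> c * norm x" for x
  proof -
    have "(norm (D x))\<^sup>2 \<le> c * inner (D x) x"
      by (rule positive_form_norm_bound[OF Dpos c(1) Dle])
    also have "\<dots> \<le> c * (c * (norm x)\<^sup>2)"
      using c Dle by (simp add: mult_left_mono)
    also have "\<dots> = (c * norm x)\<^sup>2"
      by (simp add: power2_eq_square)
    finally show ?thesis
      using c by (simp add: power2_le_iff_abs_le)
  qed
  have surj: "\<exists>x. B x = y" for y
  proof -
    have "\<exists>!x\<in>UNIV. D x + (1 / K) *\<^sub>R y = x"
    proof (rule Banach_fix[where c = c])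
      show "dist (D x + (1 / K) *\<^sub>R y) (D z + (1 / K) *\<^sub>R y) \<le> c * dist x z" for x z
        using contr[of "x - z"] by (simp add: dist_norm blinfun.diff_right)
    qed (use c in \<open>auto simp: complete_UNIV\<close>)
    then obtain x where "D x + (1 / K) *\<^sub>R y = x"
      by blast
    then have "(1 / K) *\<^sub>R (y - B x) = 0"
      by (simp add: D_def blinfun.diff_left blinfun.scaleR_left algebra_simps)
    then show ?thesis
      using K by auto
  qed
  have bb: "e * norm x \<le> norm (B x)" for x
    by (rule coercive_bounded_below[OF e])
  have inj: "B x = B y \<Longrightarrow> x = y" for x y
    using bb[of "x - y"] e(1) by (simp add: blinfun.diff_right mult_le_0_iff)
  define S where "S = inv (blinfun_apply B)"
  have BS: "B (S y) = y" for y
    unfolding S_def using surj by (metis f_inv_into_f rangeI)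
  have "bounded_linear S"
  proof (rule bounded_linear_intro[where K = "1 / e"])
    show "norm (S x) \<le> norm x * (1 / e)" for x
      using bb[of "S x"] e(1) by (simp add: BS field_simps)
    show "S (x + y) = S x + S y" for x y
      by (rule inj) (simp add: BS blinfun.add_right)
    show "S (r *\<^sub>R x) = r *\<^sub>R S x" for r x
      by (rule inj) (simp add: BS blinfun.scaleR_right)
  qed
  then have S: "blinfun_apply (Blinfun S) = S"
    by (rule bounded_linear_Blinfun_apply)
  have "S (a *\<^sub>C x) = a *\<^sub>C S x" for a x
    by (rule inj) (use B in \<open>simp add: BS selfadjoint_clinear clinear_op_commute\<close>)
  moreover have "S (B x) = x" for x
    by (rule inj) (simp add: BS)
  ultimately show ?thesis
    unfolding invertible_op_def
    by (intro exI[of _ "Blinfun S"]) (auto simp: clinear_op_def S BS intro!: blinfun_eqI)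
qed

lemma invertible_op_commuting_factor:
  assumes "clinear_op Q" "P o\<^sub>L Q = Q o\<^sub>L P" "invertible_op (P o\<^sub>L Q)"
  shows "invertible_op P"
proof -
  obtain S where S: "clinear_op S" "P o\<^sub>L Q o\<^sub>L S = id_blinfun" "S o\<^sub>L (P o\<^sub>L Q) = id_blinfun"
    using assms(3) by (auto simp: invertible_op_def)
  have PQ: "P (Q x) = Q (P x)" and PQS: "P (Q (S x)) = x" and SPQ: "S (P (Q x)) = x" for x
    using assms(2) S(2,3) by (metis blinfun_apply_blinfun_compose blinfun_apply_id_blinfun id_apply)+
  have "Q (S (P x)) = x" for x
    by (metis PQ PQS SPQ)
  then show ?thesis
    unfolding invertible_op_def
    by (intro exI[of _ "Q o\<^sub>L S"]) (auto simp: S(1) assms(1) PQS intro!: blinfun_eqI)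
qed

lemma selfadjoint_bounded_below_invertible:
  assumes B: "selfadjoint_op B" and bb: "bounded_below B"
  shows "invertible_op B"
proof -
  obtain d where d: "d > 0" "\<And>x. d * norm x \<le> norm (B x)"
    using bb by (auto simp: bounded_below_def)
  have "d\<^sup>2 * (norm x)\<^sup>2 \<le> inner ((B o\<^sub>L B) x) x" for x
    using power_mono[OF d(2)[of x], of 2] d(1) selfadjoint_inner[OF B, of "B x" x]
    by (simp add: power_mult_distrib power2_norm_eq_inner)
  then have "invertible_op (B o\<^sub>L B)"
    using coercive_invertible[of "B o\<^sub>L B" "d\<^sup>2"] B d(1) by simp
  then show ?thesis
    using invertible_op_commuting_factor[of B B] B by (simp add: selfadjoint_clinear)
qed

lemma invertible_bounded_below:
  assumes "invertible_op B"
  shows "bounded_below B"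
proof -
  obtain S where S: "S o\<^sub>L B = id_blinfun"
    using assms by (auto simp: invertible_op_def)
  have "1 / (norm S + 1) * norm x \<le> norm (B x)" for x
  proof -
    have "norm x = norm (S (B x))"
      using S by (metis blinfun_apply_blinfun_compose blinfun_apply_id_blinfun id_apply)
    also have "\<dots> \<le> norm S * norm (B x)"
      by (rule norm_blinfun)
    also have "\<dots> \<le> (norm S + 1) * norm (B x)"
      by (simp add: mult_right_mono)
    finally show ?thesis
      by (subst mult.commute, simp, subst pos_divide_le_eq)
         (simp_all add: add_nonneg_pos mult.commute)
  qed
  moreover have "0 < 1 / (norm S + 1)"
    by (simp add: add_nonneg_pos)
  ultimately show ?thesis
    unfolding bounded_below_def by blast
qed

section \<open>The spectrum of a self-adjoint operator\<close>

text \<open>The set on which the continuous functional calculus requires uniform approximation.\<close>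

abbreviation real_spectrum :: "('a::complex_hilbert \<Rightarrow>\<^sub>L 'a) \<Rightarrow> real set" where
  "real_spectrum A \<equiv> {t. complex_of_real t \<in> spectrum A}"

lemma scalar_op_of_real: "scalar_op (complex_of_real t) = t *\<^sub>R id_blinfun"
  by (rule blinfun_eqI) (simp add: scalar_op.rep_eq scaleC_of_real blinfun.scaleR_left)

lemma real_spectrum_iff:
  assumes "selfadjoint_op A"
  shows "t \<in> real_spectrum A \<longleftrightarrow> \<not> bounded_below (A - t *\<^sub>R id_blinfun)"
proof -
  have "invertible_op (A - t *\<^sub>R id_blinfun) \<longleftrightarrow> bounded_below (A - t *\<^sub>R id_blinfun)"
    using selfadjoint_bounded_below_invertible[of "A - t *\<^sub>R id_blinfun"] assms
      invertible_bounded_below[of "A - t *\<^sub>R id_blinfun"]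
    by (meson selfadjoint_op_diff selfadjoint_op_id selfadjoint_op_scaleR)
  then show ?thesis
    by (simp add: spectrum_def scalar_op_of_real)
qed

text \<open>For \<open>z = a + b \<i>\<close> the product of \<open>A - z\<close> and \<open>A - cnj z\<close> is \<open>(A - a)\<^sup>2 + b\<^sup>2\<close>,
  which is coercive unless \<open>b = 0\<close>.\<close>

lemma spectrum_real:
  assumes A: "selfadjoint_op A" and z: "z \<in> spectrum A"
  shows "Im z = 0"
proof (rule ccontr)
  assume b: "Im z \<noteq> 0"
  define C where "C = A - Re z *\<^sub>R id_blinfun"
  have C: "selfadjoint_op C"
    using A by (simp add: C_def)
  have split: "w *\<^sub>C x = Re w *\<^sub>R x + Im w *\<^sub>R (\<i> *\<^sub>C x)" for w and x :: 'a
  proof -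
    have "w *\<^sub>C x = (complex_of_real (Re w) + complex_of_real (Im w) * \<i>) *\<^sub>C x"
      using complex_eq[of w] by (simp add: mult.commute)
    then show ?thesis
      by (simp only: scaleC_add_left scaleC_scaleC[symmetric] scaleC_of_real)
  qed
  have JJ: "\<i> *\<^sub>C \<i> *\<^sub>C x = - x" for x :: 'a
    using scaleC_of_real[of "-1" x] by (simp add: scaleC_scaleC)
  have AJ: "A (\<i> *\<^sub>C x) = \<i> *\<^sub>C A x" for x
    using A by (simp add: selfadjoint_clinear clinear_op_commute)
  have CJ: "C (\<i> *\<^sub>C x) = \<i> *\<^sub>C C x" for x
    using C by (simp add: selfadjoint_clinear clinear_op_commute)
  have Pz: "(A - scalar_op w) x = C x - Im w *\<^sub>R (\<i> *\<^sub>C x)" if "Re w = Re z" for w x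
    by (simp add: C_def blinfun.diff_left scalar_op.rep_eq split[of w] that blinfun.scaleR_left)
  let ?P = "A - scalar_op z" and ?Q = "A - scalar_op (cnj z)"
  let ?R = "(C o\<^sub>L C) + (Im z)\<^sup>2 *\<^sub>R id_blinfun"
  have PQ: "?P o\<^sub>L ?Q = ?R" and QP: "?Q o\<^sub>L ?P = ?R"
    by (auto intro!: blinfun_eqI simp del: minus_blinfun.rep_eq
        simp: Pz blinfun.diff_right blinfun.add_right blinfun.scaleR_right blinfun.add_left
          blinfun.scaleR_left CJ JJ scaleC_diff_right scaleC_add_right scaleC_scaleR
          scaleR_add_right scaleR_diff_right power2_eq_square)
  have "invertible_op ?R"
  proof (rule coercive_invertible)
    show "(Im z)\<^sup>2 * (norm x)\<^sup>2 \<le> inner (?R x) x" for x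
      using selfadjoint_inner[OF C, of "C x" x]
      by (simp add: blinfun.add_left blinfun.scaleR_left inner_add_left power2_norm_eq_inner)
  qed (use b C in auto)
  then have "invertible_op ?P"
    using invertible_op_commuting_factor[of ?Q ?P] A PQ QP
    by (simp add: selfadjoint_clinear)
  then show False
    using z by (simp add: spectrum_def)
qed

lemma spectrum_eq_real_spectrum:
  assumes "selfadjoint_op A"
  shows "spectrum A = complex_of_real ` real_spectrum A"
proof -
  have "z = complex_of_real (Re z)" if "z \<in> spectrum A" for z
    using spectrum_real[OF assms that] by (simp add: complex_eq_iff)
  then show ?thesis
    by (force simp: image_iff)
qed

lemma spectrum_subset_iff:
  assumes "selfadjoint_op A"
  shows "spectrum A \<subseteq> complex_of_real ` I \<longleftrightarrow> real_spectrum A \<subseteq> I"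
  by (subst spectrum_eq_real_spectrum[OF assms]) (auto simp: image_iff)

lemma real_spectrum_lower:
  assumes A: "selfadjoint_op A" and m: "\<And>x. m * (norm x)\<^sup>2 \<le> inner (A x) x"
    and t: "t \<in> real_spectrum A"
  shows "m \<le> t"
proof (rule ccontr)
  assume "\<not> m \<le> t"
  then have "bounded_below (A - t *\<^sub>R id_blinfun)"
    unfolding bounded_below_def
    using coercive_bounded_below[of "m - t" "A - t *\<^sub>R id_blinfun"] m
    by (intro exI[of _ "m - t"])
       (simp add: blinfun.diff_left blinfun.scaleR_left inner_diff_left power2_norm_eq_inner
          algebra_simps)
  then show False
    using t real_spectrum_iff[OF A] by blast
qed

lemma compact_real_spectrum:
  assumes A: "selfadjoint_op A"
  shows "compact (real_spectrum A)"
proof -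
  have nle: "norm (A x - t *\<^sub>R x) \<ge> (\<bar>t\<bar> - norm A) * norm x" for t x
    using norm_triangle_ineq2[of "t *\<^sub>R x" "A x"] norm_blinfun[of A x]
    by (simp add: norm_minus_commute algebra_simps)
  have "\<bar>t\<bar> \<le> norm A" if "t \<in> real_spectrum A" for t
  proof (rule ccontr)
    assume "\<not> \<bar>t\<bar> \<le> norm A"
    then have "bounded_below (A - t *\<^sub>R id_blinfun)"
      unfolding bounded_below_def using nle[of t]
      by (intro exI[of _ "\<bar>t\<bar> - norm A"]) (simp add: blinfun.diff_left blinfun.scaleR_left)
    then show False
      using that real_spectrum_iff[OF A] by blast
  qed
  then have bdd: "bounded (real_spectrum A)"
    by (metis boundedI real_norm_def)
  have "open (- real_spectrum A)"
    unfolding open_dist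
  proof
    fix t assume "t \<in> - real_spectrum A"
    then have "bounded_below (A - t *\<^sub>R id_blinfun)"
      using real_spectrum_iff[OF A, of t] by simp
    then obtain d where d: "d > 0" "\<And>x. d * norm x \<le> norm (A x - t *\<^sub>R x)"
      by (auto simp: bounded_below_def blinfun.diff_left blinfun.scaleR_left)
    have "s \<notin> real_spectrum A" if "dist s t < d" for s
    proof -
      have "(d - \<bar>s - t\<bar>) * norm x \<le> norm (A x - s *\<^sub>R x)" for x
      proof -
        have "A x - t *\<^sub>R x = (A x - s *\<^sub>R x) + (s - t) *\<^sub>R x"
          by (simp add: algebra_simps)
        then have "norm (A x - t *\<^sub>R x) \<le> norm (A x - s *\<^sub>R x) + \<bar>s - t\<bar> * norm x"
          by (metis norm_triangle_ineq norm_scaleR)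
        then show ?thesis
          using d(2)[of x] by (simp add: algebra_simps)
      qed
      then have "bounded_below (A - s *\<^sub>R id_blinfun)"
        unfolding bounded_below_def using that
        by (intro exI[of _ "d - \<bar>s - t\<bar>"])
           (simp add: blinfun.diff_left blinfun.scaleR_left dist_real_def)
      then show ?thesis
        using real_spectrum_iff[OF A] by blast
    qed
    then show "\<exists>e>0. \<forall>y. dist y t < e \<longrightarrow> y \<in> - real_spectrum A"
      using d(1) by (intro exI[of _ d]) simp
  qed
  then show ?thesis
    using bdd by (simp only: compact_eq_bounded_closed closed_def)
qed

text \<open>The infimum \<open>m\<close> of the numerical range is an approximate eigenvalue: for unit vectors \<open>x\<close>
  with \<open>inner (B x) x\<close> close to \<open>m\<close>, Cauchy--Schwarz for the form of \<open>B - m\<close> makes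
  \<open>B x - m x\<close> small.\<close>

lemma lower_bound_in_real_spectrum:
  fixes B :: "'a::complex_hilbert \<Rightarrow>\<^sub>L 'a"
  assumes B: "selfadjoint_op B" and nontriv: "\<exists>x::'a. x \<noteq> 0"
  obtains m where "m \<in> real_spectrum B" "\<And>x. m * (norm x)\<^sup>2 \<le> inner (B x) x"
proof -
  define N where "N = (\<lambda>x. inner (B x) x) ` {x. norm x = 1}"
  define m where "m = Inf N"
  obtain u :: 'a where "u \<noteq> 0"
    using nontriv by blast
  then have "norm ((1 / norm u) *\<^sub>R u) = 1"
    by simp
  then have ne: "N \<noteq> {}"
    unfolding N_def by blast
  have "- norm B \<le> inner (B x) x" if "norm x = 1" for x
    using inner_le_norm_op[of "- B" x] that by (simp add: blinfun.minus_left)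
  then have bdd: "bdd_below N"
    unfolding N_def by (intro bdd_belowI2) auto
  have low: "m * (norm x)\<^sup>2 \<le> inner (B x) x" for x
  proof (cases "x = 0")
    case False
    define v where "v = (1 / norm x) *\<^sub>R x"
    have "norm v = 1"
      using False by (simp add: v_def)
    then have "m \<le> inner (B v) v"
      unfolding m_def N_def[symmetric] by (intro cInf_lower bdd) (simp add: N_def)
    also have "\<dots> = inner (B x) x / (norm x)\<^sup>2"
      by (simp add: v_def blinfun.scaleR_right power2_eq_square)
    finally show ?thesis
      using False by (simp add: field_simps)
  qed simp
  define D where "D = B - m *\<^sub>R id_blinfun"
  have Dx: "inner (D x) x = inner (B x) x - m * (norm x)\<^sup>2" for x
    by (simp add: D_def blinfun.diff_left blinfun.scaleR_left inner_diff_left power2_norm_eq_inner)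
  have D: "positive_op D"
    using B low Dx by (simp add: positive_op_iff D_def)
  have "\<not> bounded_below D"
  proof
    assume "bounded_below D"
    then obtain d where d: "d > 0" "\<And>x. d * norm x \<le> norm (D x)"
      by (auto simp: bounded_below_def)
    define K where "K = norm D + 1"
    have K: "K > 0"
      by (simp add: K_def add_nonneg_pos)
    have DK: "inner (D x) x \<le> K * (norm x)\<^sup>2" for x
      using inner_le_norm_op[of D x] by (simp add: K_def algebra_simps add_increasing)
    have "m < m + d\<^sup>2 / K"
      using d(1) K by simp
    then obtain x where x: "norm x = 1" "inner (B x) x < m + d\<^sup>2 / K"
      using cInf_lessD[OF ne, of "m + d\<^sup>2 / K"] unfolding m_def by (auto simp: N_def)
    have "d\<^sup>2 \<le> (norm (D x))\<^sup>2"
      using d(1) d(2)[of x] x(1) by (simp add: power_mono)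
    also have "\<dots> \<le> K * inner (D x) x"
      by (rule positive_form_norm_bound[OF D K DK])
    also have "\<dots> < d\<^sup>2"
      using x K by (simp add: Dx field_simps)
    finally show False
      by simp
  qed
  then have "m \<in> real_spectrum B"
    using real_spectrum_iff[OF B] D_def by blast
  then show ?thesis
    using low that by blast
qed

lemma positive_op_iff_spectrum:
  fixes B :: "'a::complex_hilbert \<Rightarrow>\<^sub>L 'a"
  assumes B: "selfadjoint_op B"
  shows "positive_op B \<longleftrightarrow> real_spectrum B \<subseteq> {0..}"
proof
  assume "positive_op B"
  then show "real_spectrum B \<subseteq> {0..}"
    using real_spectrum_lower[OF B, of 0] by (auto simp: positive_op_iff)
next
  assume sp: "real_spectrum B \<subseteq> {0..}"
  show "positive_op B"
  proof (cases "\<exists>x::'a. x \<noteq> 0")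
    case True
    then obtain m where m: "m \<in> real_spectrum B" "\<And>x. m * (norm x)\<^sup>2 \<le> inner (B x) x"
      using lower_bound_in_real_spectrum[OF B] by blast
    then have "0 \<le> m"
      using sp by auto
    then have "0 \<le> inner (B x) x" for x
      using m(2)[of x] by (smt (verit) mult_nonneg_nonneg zero_le_power2)
    then show ?thesis
      using B by (simp add: positive_op_iff)
  next
    case False
    then show ?thesis
      using B by (metis inner_zero_right order_refl positive_op_iff)
  qed
qed

lemma positive_op_spectrum: "positive_op A \<Longrightarrow> real_spectrum A \<subseteq> {0..}"
  using positive_op_iff_spectrum positive_op_selfadjoint by blast

lemma strictly_positive_op_iff_spectrum:
  assumes B: "selfadjoint_op B"
  shows "strictly_positive_op B \<longleftrightarrow> real_spectrum B \<subseteq> {0<..}"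
proof -
  have "0 \<in> real_spectrum B \<longleftrightarrow> \<not> invertible_op B"
    by (simp add: spectrum_def scalar_op_of_real[of 0, unfolded of_real_0 scaleR_zero_left])
  moreover have "S \<subseteq> {0<..} \<longleftrightarrow> S \<subseteq> {0..} \<and> 0 \<notin> S" for S :: "real set"
    by (force simp: less_le)
  ultimately show ?thesis
    unfolding strictly_positive_op_def positive_op_iff_spectrum[OF B] by metis
qed

section \<open>Polynomials of a self-adjoint operator\<close>

lemma op_power_0 [simp]: "op_power A 0 = id_blinfun"
  and op_power_Suc [simp]: "op_power A (Suc n) = A o\<^sub>L op_power A n"
  by (simp_all add: op_power_def)

lemma poly_op_eq_sum:
  assumes "degree p \<le> n"
  shows "poly_op p A = (\<Sum>i\<le>n. coeff p i *\<^sub>R op_power A i)"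
  unfolding poly_op_def using assms
  by (intro sum.mono_neutral_left) (auto simp: coeff_eq_0)

lemma blinfun_compose_sum_right: "A o\<^sub>L (\<Sum>i\<in>I. T i) = (\<Sum>i\<in>I. A o\<^sub>L T i)"
  by (rule blinfun_eqI) (simp add: blinfun.sum_left blinfun.sum_right)

lemma poly_op_0 [simp]: "poly_op 0 A = 0"
  by (simp add: poly_op_def)

lemma poly_op_pCons: "poly_op (pCons a p) A = a *\<^sub>R id_blinfun + (A o\<^sub>L poly_op p A)"
proof -
  have "poly_op (pCons a p) A = (\<Sum>i\<le>Suc (degree p). coeff (pCons a p) i *\<^sub>R op_power A i)"
    by (rule poly_op_eq_sum) (rule degree_pCons_le)
  also have "\<dots> = a *\<^sub>R id_blinfun + (\<Sum>i\<le>degree p. coeff p i *\<^sub>R (A o\<^sub>L op_power A i))"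
    by (subst sum.atMost_Suc_shift) simp
  also have "(\<Sum>i\<le>degree p. coeff p i *\<^sub>R (A o\<^sub>L op_power A i)) = A o\<^sub>L poly_op p A"
    by (simp add: poly_op_def blinfun_compose_sum_right blinfun_eqI blinfun.scaleR_right
        blinfun.scaleR_left blinfun.sum_left)
  finally show ?thesis .
qed

lemma poly_op_const [simp]: "poly_op [:a:] A = a *\<^sub>R id_blinfun"
  by (rule blinfun_eqI) (simp add: poly_op_pCons blinfun.add_left)

lemma poly_op_add: "poly_op (p + q) A = poly_op p A + poly_op q A"
proof -
  let ?n = "max (degree p) (degree q)"
  have "poly_op (p + q) A = (\<Sum>i\<le>?n. coeff (p + q) i *\<^sub>R op_power A i)"
    by (rule poly_op_eq_sum) (rule degree_add_le_max)
  also have "\<dots> = poly_op p A + poly_op q A"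
    by (simp add: poly_op_eq_sum[of p ?n] poly_op_eq_sum[of q ?n] scaleR_add_left sum.distrib)
  finally show ?thesis .
qed

lemma poly_op_smult: "poly_op (smult c p) A = c *\<^sub>R poly_op p A"
  by (subst poly_op_eq_sum[OF degree_smult_le]) (simp add: poly_op_def scaleR_sum_right)

lemma poly_op_diff: "poly_op (p - q) A = poly_op p A - poly_op q A"
  using poly_op_add[of p "- q" A] poly_op_smult[of "-1" q A] by simp

lemma poly_op_mult: "poly_op (p * q) A = poly_op p A o\<^sub>L poly_op q A"
proof (induction p rule: pCons_induct)
  case 0
  then show ?case
    by (simp add: blinfun_eqI)
next
  case (pCons a p)
  then show ?case
    by (auto simp: poly_op_add poly_op_smult poly_op_pCons blinfun.add_left blinfun.scaleR_left
        intro!: blinfun_eqI)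
qed

lemma poly_op_intertwine:
  fixes A B W :: "'a::complex_hilbert \<Rightarrow>\<^sub>L 'a"
  assumes "\<And>x. A (W x) = W (B x)"
  shows "poly_op p A (W x) = W (poly_op p B x)"
proof (induction p rule: pCons_induct)
  case (pCons a p)
  then show ?case
    by (simp add: poly_op_pCons assms blinfun.add_left blinfun.scaleR_left blinfun.add_right
        blinfun.scaleR_right)
qed simp

lemma selfadjoint_poly_op:
  assumes A: "selfadjoint_op A"
  shows "selfadjoint_op (poly_op p A)"
proof (induction p rule: pCons_induct)
  case (pCons a p)
  have "A (poly_op p A x) = poly_op p A (A x)" for x
    by (simp add: poly_op_intertwine)
  then have "selfadjoint_op (A o\<^sub>L poly_op p A)"
    using A pCons by (simp add: selfadjoint_op_iff)
  then show ?case
    by (simp add: poly_op_pCons)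
qed simp

definition complex_value :: "real poly \<Rightarrow> complex \<Rightarrow> complex" where
  "complex_value p z = poly (map_poly of_real p) z"

lemma complex_value_pCons [simp]:
  "complex_value (pCons a p) z = of_real a + z * complex_value p z"
  by (simp add: complex_value_def map_poly_pCons)

lemma complex_value_0 [simp]: "complex_value 0 z = 0"
  by (simp add: complex_value_def)

lemma complex_value_add [simp]: "complex_value (p + q) z = complex_value p z + complex_value q z"
  by (induction p q rule: poly_induct2) (simp_all add: algebra_simps)

lemma complex_value_smult [simp]: "complex_value (smult c p) z = of_real c * complex_value p z"
  by (induction p) (simp_all add: algebra_simps)

lemma complex_value_mult [simp]: "complex_value (p * q) z = complex_value p z * complex_value q z"
  by (induction p) (simp_all add: algebra_simps)

lemma complex_value_of_real: "complex_value p (of_real t) = of_real (poly p t)"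
  by (induction p) simp_all

lemma complex_value_root:
  assumes "degree p > 0"
  obtains z where "complex_value p z = 0"
proof -
  have "\<not> constant (poly (map_poly complex_of_real p))"
    using assms by (simp add: constant_degree degree_map_poly)
  then show ?thesis
    using fundamental_theorem_of_algebra that unfolding complex_value_def by blast
qed

lemma real_quadratic_dvd:
  assumes z: "complex_value p z = 0" and b: "Im z \<noteq> 0"
  shows "[:(cmod z)\<^sup>2, - 2 * Re z, 1:] dvd p"
proof -
  let ?d = "[:(cmod z)\<^sup>2, - 2 * Re z, 1:]"
  define r where "r = p mod ?d"
  have d: "complex_value ?d z = 0"
    by (simp add: complex_eq_iff cmod_power2) (simp add: power2_eq_square algebra_simps)
  have "p = (p div ?d) * ?d + r"
    unfolding r_def by (rule div_mult_mod_eq[symmetric])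
  then have "complex_value r z = 0"
    using z d by (metis add_0 complex_value_add complex_value_mult mult_zero_right)
  moreover obtain a b' where r: "r = [:a, b':]"
  proof -
    obtain a q where aq: "r = pCons a q"
      by (cases r)
    have "degree r < 2"
      using degree_mod_less[of ?d p] by (auto simp: r_def)
    then have "degree q = 0"
      using aq by (cases "q = 0") auto
    then show ?thesis
      using that aq by (metis degree_eq_zeroE)
  qed
  ultimately have "of_real a + z * of_real b' = 0"
    by simp
  then have "b' = 0" "a = 0"
    using b by (auto simp: complex_eq_iff)
  then show ?thesis
    using r by (simp add: r_def mod_eq_0_iff_dvd)
qed

text \<open>A real polynomial factors into linear factors \<open>X - r\<close> and quadratic factors
  \<open>(X - a)\<^sup>2 + b\<^sup>2\<close>. The former are bounded below at \<open>A\<close> because \<open>r\<close> avoids the spectrum,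
  the latter because they are coercive.\<close>

lemma poly_op_bounded_below:
  assumes A: "selfadjoint_op A"
  shows "p \<noteq> 0 \<Longrightarrow> (\<And>t. t \<in> real_spectrum A \<Longrightarrow> poly p t \<noteq> 0) \<Longrightarrow> bounded_below (poly_op p A)"
proof (induction "degree p" arbitrary: p rule: less_induct)
  case less
  have step: ?case if d: "p = d * q" "degree d > 0" "bounded_below (poly_op d A)" for d q
  proof -
    have "degree q < degree p" "q \<noteq> 0"
      using d less.prems(1) by (auto simp: degree_mult_eq)
    then have "bounded_below (poly_op q A)"
      using less.hyps[of q] less.prems(2) d(1) by auto
    then show ?thesis
      using d by (simp add: poly_op_mult bounded_below_compose)
  qed
  show ?case
  proof (cases "degree p = 0")
    case True
    then obtain c where "p = [:c:]" "c \<noteq> 0"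
      using less.prems(1) by (metis degree_eq_zeroE pCons_0_0)
    then show ?thesis
      by (auto simp: bounded_below_def blinfun.scaleR_left intro!: exI[of _ "\<bar>c\<bar>"])
  next
    case False
    then obtain z where z: "complex_value p z = 0"
      using complex_value_root by auto
    show ?thesis
    proof (cases "Im z = 0")
      case True
      define r where "r = Re z"
      have zr: "z = of_real r"
        using True by (simp add: r_def complex_eq_iff)
      then have root: "poly p r = 0"
        using z complex_value_of_real[of p r] by simp
      then obtain q where q: "p = [:- r, 1:] * q"
        by (metis dvdE poly_eq_0_iff_dvd)
      have "poly_op [:- r, 1:] A = A - r *\<^sub>R id_blinfun"
        by (rule blinfun_eqI)
           (simp add: poly_op_pCons blinfun.add_left blinfun.diff_left blinfun.scaleR_left)
      moreover have "bounded_below (A - r *\<^sub>R id_blinfun)"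
        using real_spectrum_iff[OF A] less.prems(2) root by blast
      ultimately show ?thesis
        using step[OF q] by simp
    next
      case im: False
      let ?d = "[:(cmod z)\<^sup>2, - 2 * Re z, 1:]"
      obtain q where q: "p = ?d * q"
        using real_quadratic_dvd[OF z im] by (auto elim: dvdE)
      have coer: "(Im z)\<^sup>2 * (norm x)\<^sup>2 \<le> inner (poly_op ?d A x) x" for x
      proof -
        have "poly_op ?d A x = A (A x) - (2 * Re z) *\<^sub>R A x + ((Re z)\<^sup>2 + (Im z)\<^sup>2) *\<^sub>R x"
          by (simp add: poly_op_pCons blinfun.add_left blinfun.diff_left blinfun.scaleR_left
              blinfun.scaleR_right blinfun.diff_right blinfun.add_right cmod_power2)
        then have "inner (poly_op ?d A x) x - (Im z)\<^sup>2 * (norm x)\<^sup>2 = (norm (A x - Re z *\<^sub>R x))\<^sup>2"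
          using selfadjoint_inner[OF A, of "A x" x]
          by (simp add: power2_norm_eq_inner[where 'a='a]) (simp add: inner_diff_left inner_diff_right inner_add_left inner_commute
              algebra_simps power2_eq_square)
        then show ?thesis
          by (smt (verit) zero_le_power2)
      qed
      have "bounded_below (poly_op ?d A)"
        unfolding bounded_below_def
        using coercive_bounded_below[OF _ coer] im by (intro exI[of _ "(Im z)\<^sup>2"]) auto
      then show ?thesis
        using step[OF q] by simp
    qed
  qed
qed

text \<open>For \<open>e > 0\<close> the polynomial \<open>p + e\<close> has no zero on the spectrum, so \<open>-e\<close> is not in the
  spectrum of \<open>p(A)\<close>.\<close>

lemma poly_op_positive:
  fixes A :: "'a::complex_hilbert \<Rightarrow>\<^sub>L 'a"
  assumes A: "selfadjoint_op A" and p: "\<And>t. t \<in> real_spectrum A \<Longrightarrow> 0 \<le> poly p t"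
  shows "positive_op (poly_op p A)"
proof (cases "\<exists>x::'a. x \<noteq> 0")
  case False
  then show ?thesis
    using selfadjoint_poly_op[OF A] by (metis inner_zero_right order_refl positive_op_iff)
next
  case True
  \<comment> \<open>a point of the spectrum ensures that \<open>p - s\<close> below is not the zero polynomial\<close>
  obtain m where m: "m \<in> real_spectrum A"
    using lower_bound_in_real_spectrum[OF A True] by blast
  have "s \<notin> real_spectrum (poly_op p A)" if "s < 0" for s
  proof -
    have pos: "poly (p - [:s:]) t > 0" if "t \<in> real_spectrum A" for t
      using p[OF that] \<open>s < 0\<close> by simp
    have "bounded_below (poly_op (p - [:s:]) A)"
    proof (rule poly_op_bounded_below[OF A])
      show "p - [:s:] \<noteq> 0"
        using pos[OF m] by auto
    qed (use pos in force)
    then show ?thesis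
      using real_spectrum_iff[OF selfadjoint_poly_op[OF A, of p], of s] by (simp add: poly_op_diff)
  qed
  then show ?thesis
    by (subst positive_op_iff_spectrum[OF selfadjoint_poly_op[OF A]]) (auto simp: not_less[symmetric])
qed

text \<open>Positivity of \<open>M\<^sup>2 - p\<^sup>2\<close> on the spectrum bounds the norm of \<open>p(A) x\<close>.\<close>

lemma norm_poly_op_le:
  assumes A: "selfadjoint_op A" and M: "0 \<le> M" "\<And>t. t \<in> real_spectrum A \<Longrightarrow> \<bar>poly p t\<bar> \<le> M"
  shows "norm (poly_op p A) \<le> M"
proof (rule norm_blinfun_bound[OF M(1)])
  fix x
  have "poly ([:M\<^sup>2:] - p * p) t \<ge> 0" if "t \<in> real_spectrum A" for t
    using power_mono[OF M(2)[OF that], of 2] by (simp add: power2_eq_square)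
  then have "positive_op (poly_op ([:M\<^sup>2:] - p * p) A)"
    by (rule poly_op_positive[OF A])
  then have "0 \<le> inner (poly_op ([:M\<^sup>2:] - p * p) A x) x"
    by (simp add: positive_op_iff)
  also have "\<dots> = (M * norm x)\<^sup>2 - (norm (poly_op p A x))\<^sup>2"
    using selfadjoint_inner[OF selfadjoint_poly_op[OF A], of p "poly_op p A x" x]
    by (simp add: poly_op_diff poly_op_mult blinfun.diff_left blinfun.scaleR_left inner_diff_left
        power_mult_distrib power2_norm_eq_inner)
  finally show "norm (poly_op p A x) \<le> M * norm x"
    using M(1) by (simp add: power2_le_iff_abs_le)
qed

section \<open>The continuous functional calculus\<close>

lemma polynomial_approximation:
  fixes f :: "real \<Rightarrow> real"
  assumes "compact S" "continuous_on S f"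
  obtains p :: "nat \<Rightarrow> real poly" where "uniform_limit S (\<lambda>n. poly (p n)) f sequentially"
proof -
  have "\<exists>p. \<forall>x\<in>S. \<bar>f x - poly p x\<bar> < 1 / real (Suc n)" for n
  proof -
    obtain g where g: "real_polynomial_function g" "\<And>x. x \<in> S \<Longrightarrow> \<bar>f x - g x\<bar> < 1 / real (Suc n)"
      using Stone_Weierstrass_real_polynomial_function[OF assms, of "1 / real (Suc n)"] by auto
    then obtain a k where "g = (\<lambda>x. \<Sum>i\<le>k. a i * x ^ i)"
      using real_polynomial_function_iff_sum by blast
    then have "g = poly (\<Sum>i\<le>k. monom (a i) i)"
      by (simp add: fun_eq_iff poly_sum poly_monom)
    then show ?thesis
      using g(2) by blast
  qed
  then obtain p where p: "\<And>n x. x \<in> S \<Longrightarrow> \<bar>f x - poly (p n) x\<bar> < 1 / real (Suc n)"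
    by metis
  have "uniform_limit S (\<lambda>n. poly (p n)) f sequentially"
  proof (rule uniform_limitI)
    fix e :: real assume "e > 0"
    then have "\<forall>\<^sub>F n in sequentially. 1 / real (Suc n) < e"
      using order_tendstoD(2)[OF LIMSEQ_inverse_real_of_nat] by (simp add: inverse_eq_divide)
    then show "\<forall>\<^sub>F n in sequentially. \<forall>x\<in>S. dist (poly (p n) x) (f x) < e"
    proof eventually_elim
      case (elim n)
      then show ?case
        using p[of _ n] unfolding dist_real_def by (metis abs_minus_commute order_less_trans)
    qed
  qed
  then show ?thesis
    using that by blast
qed

text \<open>Two sequences that approximate the same function are compared here; taking them equal gives
  existence of the limit that defines \<open>f(A)\<close>, taking them different gives its uniqueness.\<close>

lemma poly_op_approximations_close:
  assumes A: "selfadjoint_op A"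
    and p: "uniform_limit (real_spectrum A) (\<lambda>n. poly (p n)) f sequentially"
    and q: "uniform_limit (real_spectrum A) (\<lambda>n. poly (q n)) f sequentially"
    and e: "e > 0"
  shows "\<exists>N. \<forall>m\<ge>N. \<forall>n\<ge>N. norm (poly_op (p m) A - poly_op (q n) A) < e"
proof -
  have "\<forall>\<^sub>F n in sequentially. (\<forall>t\<in>real_spectrum A. dist (poly (p n) t) (f t) < e / 4) \<and>
     (\<forall>t\<in>real_spectrum A. dist (poly (q n) t) (f t) < e / 4)"
    using uniform_limitD[OF p, of "e / 4"] uniform_limitD[OF q, of "e / 4"] e
    by (simp add: eventually_conj_iff)
  then obtain N where N: "\<And>n t. n \<ge> N \<Longrightarrow> t \<in> real_spectrum A \<Longrightarrow>
      \<bar>poly (p n) t - f t\<bar> < e / 4 \<and> \<bar>poly (q n) t - f t\<bar> < e / 4"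
    unfolding eventually_sequentially dist_real_def by blast
  have "norm (poly_op (p m) A - poly_op (q n) A) < e" if "m \<ge> N" "n \<ge> N" for m n
  proof -
    have "norm (poly_op (p m - q n) A) \<le> e / 2"
    proof (rule norm_poly_op_le[OF A])
      show "\<bar>poly (p m - q n) t\<bar> \<le> e / 2" if "t \<in> real_spectrum A" for t
        using N[OF \<open>m \<ge> N\<close> that] N[OF \<open>n \<ge> N\<close> that] unfolding poly_diff by linarith
    qed (use e in simp)
    then show ?thesis
      using e by (simp add: poly_op_diff)
  qed
  then show ?thesis
    by blast
qed

lemma cfc_tendsto:
  assumes A: "selfadjoint_op A"
    and p: "uniform_limit (real_spectrum A) (\<lambda>n. poly (p n)) f sequentially"
  shows "(\<lambda>n. poly_op (p n) A) \<longlonglongrightarrow> cfc f A"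
proof -
  have "Cauchy (\<lambda>n. poly_op (p n) A)"
    using poly_op_approximations_close[OF A p p] by (simp add: Cauchy_def dist_norm)
  then obtain T where T: "(\<lambda>n. poly_op (p n) A) \<longlonglongrightarrow> T"
    by (auto simp: Cauchy_convergent_iff convergent_def)
  have "T' = T" if "uniform_limit (real_spectrum A) (\<lambda>n. poly (q n)) f sequentially"
    "(\<lambda>n. poly_op (q n) A) \<longlonglongrightarrow> T'" for q T'
  proof -
    have "(\<lambda>n. poly_op (p n) A - poly_op (q n) A) \<longlonglongrightarrow> 0"
      unfolding LIMSEQ_iff using poly_op_approximations_close[OF A p that(1)] by fastforce
    then show ?thesis
      using tendsto_diff[OF T that(2)] LIMSEQ_unique by fastforce
  qed
  then have "cfc f A = T"
    unfolding cfc_def using p T by (intro the_equality) blast+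
  then show ?thesis
    using T by simp
qed

lemma selfadjoint_op_lim:
  assumes "\<And>n. selfadjoint_op (T n)" "T \<longlonglongrightarrow> S"
  shows "selfadjoint_op S"
proof -
  have lim: "(\<lambda>n. T n x) \<longlonglongrightarrow> S x" for x
    using assms(2) by (rule blinfun.tendsto) simp
  have "S (c *\<^sub>C x) = c *\<^sub>C S x" for c x
  proof (rule LIMSEQ_unique[OF lim])
    show "(\<lambda>n. T n (c *\<^sub>C x)) \<longlonglongrightarrow> c *\<^sub>C S x"
      using bounded_linear.tendsto[OF bounded_linear_scaleC lim[of x], of c] assms(1)
      by (simp add: selfadjoint_clinear clinear_op_commute)
  qed
  moreover have "inner (S x) y = inner x (S y)" for x y
  proof (rule LIMSEQ_unique)
    show "(\<lambda>n. inner (T n x) y) \<longlonglongrightarrow> inner (S x) y"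
      by (intro tendsto_intros lim)
    show "(\<lambda>n. inner (T n x) y) \<longlonglongrightarrow> inner x (S y)"
      unfolding selfadjoint_inner[OF assms(1)] by (intro tendsto_intros lim)
  qed
  ultimately show ?thesis
    by (simp add: selfadjoint_op_iff clinear_op_def)
qed

context
  fixes A :: "'a::complex_hilbert \<Rightarrow>\<^sub>L 'a"
  assumes A: "selfadjoint_op A"
begin

lemma cfc_approximation:
  assumes "continuous_on (real_spectrum A) f"
  obtains p where "uniform_limit (real_spectrum A) (\<lambda>n. poly (p n)) f sequentially"
    "(\<lambda>n. poly_op (p n) A) \<longlonglongrightarrow> cfc f A"
proof -
  obtain p where "uniform_limit (real_spectrum A) (\<lambda>n. poly (p n)) f sequentially"
    using polynomial_approximation[OF compact_real_spectrum[OF A] assms] .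
  then show ?thesis
    using that cfc_tendsto[OF A] by blast
qed

lemma selfadjoint_cfc:
  assumes "continuous_on (real_spectrum A) f"
  shows "selfadjoint_op (cfc f A)"
proof -
  obtain p where "(\<lambda>n. poly_op (p n) A) \<longlonglongrightarrow> cfc f A"
    using cfc_approximation[OF assms] .
  then show ?thesis
    by (rule selfadjoint_op_lim[OF selfadjoint_poly_op[OF A]])
qed

lemma cfc_poly: "cfc (poly p) A = poly_op p A"
proof (rule LIMSEQ_unique)
  show "(\<lambda>_. poly_op p A) \<longlonglongrightarrow> cfc (poly p) A"
    by (rule cfc_tendsto[OF A uniform_limit_const])
qed (rule tendsto_const)

lemma cfc_cong:
  assumes "\<And>t. t \<in> real_spectrum A \<Longrightarrow> f t = g t"
  shows "cfc f A = cfc g A"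
proof -
  have "uniform_limit (real_spectrum A) p f sequentially \<longleftrightarrow>
      uniform_limit (real_spectrum A) p g sequentially" for p :: "nat \<Rightarrow> real \<Rightarrow> real"
    by (rule uniform_limit_cong') (simp_all add: assms)
  then show ?thesis
    unfolding cfc_def by simp
qed

lemma cfc_const:
  assumes "\<And>t. t \<in> real_spectrum A \<Longrightarrow> f t = c"
  shows "cfc f A = c *\<^sub>R id_blinfun"
proof -
  have "cfc f A = cfc (poly [:c:]) A"
    by (rule cfc_cong) (simp add: assms)
  then show ?thesis
    by (simp only: cfc_poly poly_op_const)
qed

lemma cfc_ident:
  assumes "\<And>t. t \<in> real_spectrum A \<Longrightarrow> f t = t"
  shows "cfc f A = A"
proof -
  have "poly_op [:0, 1:] A = A"
    by (rule blinfun_eqI) (simp add: poly_op_pCons blinfun.add_left)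
  moreover have "cfc f A = cfc (poly [:0, 1:]) A"
    by (rule cfc_cong) (simp add: assms)
  ultimately show ?thesis
    by (simp only: cfc_poly)
qed

lemma cfc_scaleR:
  assumes f: "continuous_on (real_spectrum A) f"
  shows "cfc (\<lambda>t. c * f t) A = c *\<^sub>R cfc f A"
proof -
  obtain p where p: "uniform_limit (real_spectrum A) (\<lambda>n. poly (p n)) f sequentially"
    "(\<lambda>n. poly_op (p n) A) \<longlonglongrightarrow> cfc f A"
    using cfc_approximation[OF f] .
  have "uniform_limit (real_spectrum A) (\<lambda>n. poly (smult c (p n))) (\<lambda>t. c * f t) sequentially"
    using bounded_linear.uniform_limit[OF bounded_linear_mult_right p(1), of c]
    unfolding poly_smult .
  from cfc_tendsto[OF A this] have "(\<lambda>n. c *\<^sub>R poly_op (p n) A) \<longlonglongrightarrow> cfc (\<lambda>t. c * f t) A"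
    unfolding poly_op_smult .
  moreover have "(\<lambda>n. c *\<^sub>R poly_op (p n) A) \<longlonglongrightarrow> c *\<^sub>R cfc f A"
    by (intro tendsto_intros p)
  ultimately show ?thesis
    by (rule LIMSEQ_unique)
qed

lemma cfc_uminus:
  "continuous_on (real_spectrum A) f \<Longrightarrow> cfc (\<lambda>t. - f t) A = - cfc f A"
  using cfc_scaleR[of f "-1"] by simp

lemma cfc_mult:
  assumes f: "continuous_on (real_spectrum A) f" and g: "continuous_on (real_spectrum A) g"
  shows "cfc (\<lambda>t. f t * g t) A = cfc f A o\<^sub>L cfc g A"
proof -
  obtain p where p: "uniform_limit (real_spectrum A) (\<lambda>n. poly (p n)) f sequentially"
    "(\<lambda>n. poly_op (p n) A) \<longlonglongrightarrow> cfc f A"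
    using cfc_approximation[OF f] .
  obtain q where q: "uniform_limit (real_spectrum A) (\<lambda>n. poly (q n)) g sequentially"
    "(\<lambda>n. poly_op (q n) A) \<longlonglongrightarrow> cfc g A"
    using cfc_approximation[OF g] .
  have bdd: "bounded (h ` real_spectrum A)" if "continuous_on (real_spectrum A) h" for h :: "real \<Rightarrow> real"
    using compact_continuous_image[OF that compact_real_spectrum[OF A]] compact_imp_bounded by blast
  have "uniform_limit (real_spectrum A) (\<lambda>n. poly (p n * q n)) (\<lambda>t. f t * g t) sequentially"
    unfolding poly_mult by (intro uniform_lim_mult p q bdd f g)
  from cfc_tendsto[OF A this]
  have "(\<lambda>n. poly_op (p n) A o\<^sub>L poly_op (q n) A) \<longlonglongrightarrow> cfc (\<lambda>t. f t * g t) A"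
    unfolding poly_op_mult .
  moreover have "(\<lambda>n. poly_op (p n) A o\<^sub>L poly_op (q n) A) \<longlonglongrightarrow> (cfc f A o\<^sub>L cfc g A)"
    by (intro bounded_bilinear.tendsto[OF bounded_bilinear_blinfun_compose] p q)
  ultimately show ?thesis
    by (rule LIMSEQ_unique)
qed

text \<open>A nonnegative function is a square, so \<open>f(A)\<close> is the square of a self-adjoint operator.\<close>

lemma cfc_positive:
  assumes f: "continuous_on (real_spectrum A) f" and "\<And>t. t \<in> real_spectrum A \<Longrightarrow> 0 \<le> f t"
  shows "positive_op (cfc f A)"
proof -
  let ?g = "\<lambda>t. sqrt (f t)"
  have g: "continuous_on (real_spectrum A) ?g"
    by (intro continuous_intros f)
  have "cfc f A = cfc (\<lambda>t. ?g t * ?g t) A"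
    by (rule cfc_cong) (simp add: assms(2))
  then have "cfc f A = cfc ?g A o\<^sub>L cfc ?g A"
    using cfc_mult[OF g g] by simp
  then have "inner (cfc f A x) x = (norm (cfc ?g A x))\<^sup>2" for x
    using selfadjoint_inner[OF selfadjoint_cfc[OF g], of "cfc ?g A x" x]
    by (simp add: power2_norm_eq_inner)
  then show ?thesis
    using selfadjoint_cfc[OF f] by (simp add: positive_op_iff)
qed

end

text \<open>One sequence of polynomials converges to \<open>f\<close> on both spectra at once, and each polynomial
  intertwines.\<close>

lemma cfc_intertwine:
  fixes A B W :: "'a::complex_hilbert \<Rightarrow>\<^sub>L 'a"
  assumes A: "selfadjoint_op A" and B: "selfadjoint_op B"
    and W: "\<And>x. A (W x) = W (B x)"
    and f: "continuous_on I f" "real_spectrum A \<subseteq> I" "real_spectrum B \<subseteq> I"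
  shows "cfc f A (W x) = W (cfc f B x)"
proof -
  have "compact (real_spectrum A \<union> real_spectrum B)"
    using compact_real_spectrum A B by blast
  moreover have "continuous_on (real_spectrum A \<union> real_spectrum B) f"
    using continuous_on_subset[OF f(1)] f(2,3) by blast
  ultimately obtain p where
    p: "uniform_limit (real_spectrum A \<union> real_spectrum B) (\<lambda>n. poly (p n)) f sequentially"
    using polynomial_approximation by blast
  have pA: "(\<lambda>n. poly_op (p n) A) \<longlonglongrightarrow> cfc f A" and pB: "(\<lambda>n. poly_op (p n) B) \<longlonglongrightarrow> cfc f B"
    by (rule cfc_tendsto[OF A uniform_limit_on_subset[OF p]]
        cfc_tendsto[OF B uniform_limit_on_subset[OF p]]; blast)+
  have lim1: "(\<lambda>n. poly_op (p n) A (W x)) \<longlonglongrightarrow> cfc f A (W x)"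
    by (intro blinfun.tendsto pA tendsto_const)
  have lim2: "(\<lambda>n. W (poly_op (p n) B x)) \<longlonglongrightarrow> W (cfc f B x)"
    by (intro blinfun.tendsto pB tendsto_const)
  show ?thesis
    using LIMSEQ_unique[OF lim1] lim2 by (simp add: poly_op_intertwine[where A=A and W=W, OF W])
qed

lemma real_spectrum_scalar: "real_spectrum (c *\<^sub>R id_blinfun :: 'a::complex_hilbert \<Rightarrow>\<^sub>L 'a) \<subseteq> {c}"
proof
  fix t assume t: "t \<in> real_spectrum (c *\<^sub>R id_blinfun :: 'a \<Rightarrow>\<^sub>L 'a)"
  have "\<not> bounded_below ((c - t) *\<^sub>R id_blinfun :: 'a \<Rightarrow>\<^sub>L 'a)"
    using t real_spectrum_iff[of "c *\<^sub>R id_blinfun :: 'a \<Rightarrow>\<^sub>L 'a" t] by (simp add: scaleR_diff_left)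
  moreover have "\<bar>c - t\<bar> * norm x \<le> norm (((c - t) *\<^sub>R id_blinfun :: 'a \<Rightarrow>\<^sub>L 'a) x)" for x
    by (simp add: blinfun.scaleR_left)
  ultimately have "\<not> 0 < \<bar>c - t\<bar>"
    unfolding bounded_below_def by blast
  then show "t \<in> {c}"
    by simp
qed

lemma cfc_scalar: "cfc f (c *\<^sub>R id_blinfun) = f c *\<^sub>R id_blinfun"
  using real_spectrum_scalar by (intro cfc_const) auto

section \<open>Isometries with orthogonal ranges\<close>

lemma bounded_linear_cinner_left: "bounded_linear (\<lambda>x::'a::complex_hilbert. cinner x y)"
proof -
  have "cinner x y = Complex (inner x y) (inner x (\<i> *\<^sub>C y))" for x
    by (simp add: complex_eq_iff Im_cinner inner_eq_Re_cinner)
  then have "(\<lambda>x. cinner x y) = (\<lambda>x. of_real (inner x y) + \<i> * of_real (inner x (\<i> *\<^sub>C y)))"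
    by (simp add: fun_eq_iff complex_eq_iff)
  moreover have "bounded_linear (\<lambda>x. complex_of_real (inner x y) + \<i> * of_real (inner x (\<i> *\<^sub>C y)))"
    by (intro bounded_linear_add bounded_linear_compose[OF bounded_linear_of_real bounded_linear_inner_left]
        bounded_linear_compose[OF bounded_linear_mult_right
          bounded_linear_compose[OF bounded_linear_of_real bounded_linear_inner_left]])
  ultimately show ?thesis
    by simp
qed

lemma bounded_linear_cinner_right: "bounded_linear (\<lambda>y::'a::complex_hilbert. cinner x y)"
proof -
  have "(\<lambda>y. cinner x y) = (\<lambda>y. cnj (cinner y x))"
    by (rule ext) (rule cinner_commute)
  then show ?thesis
    using bounded_linear_compose[OF bounded_linear_cnj bounded_linear_cinner_left[of x]] by simp
qed

lemma cinner_self: "cinner x x = complex_of_real ((norm x)\<^sup>2)"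
proof (rule complex_eqI)
  show "Re (cinner x x) = Re (complex_of_real ((norm x)\<^sup>2))"
    by (simp only: Re_complex_of_real power2_norm_eq_inner inner_eq_Re_cinner)
  have "Im (cinner x x) = - Im (cinner x x)"
    by (subst (1) cinner_commute) simp
  then show "Im (cinner x x) = Im (complex_of_real ((norm x)\<^sup>2))"
    by (simp only: Im_complex_of_real equal_neg_zero)
qed

lemma cinner_diff_left: "cinner (x - y) z = cinner x z - cinner (y::'a::complex_hilbert) z"
  using bounded_linear.linear[OF bounded_linear_cinner_left] by (rule linear_diff)

definition orthonormal_family :: "'i set \<Rightarrow> ('i \<Rightarrow> 'a::complex_hilbert) \<Rightarrow> bool" where
  "orthonormal_family I u \<longleftrightarrow> (\<forall>i\<in>I. \<forall>j\<in>I. cinner (u i) (u j) = (if i = j then 1 else 0))"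

text \<open>Such series need not converge absolutely; by Pythagoras the Cauchy criterion for the vectors
  is the one for the squares of their norms.\<close>

lemma orthogonal_summable_on:
  fixes f :: "'i \<Rightarrow> 'a::{real_inner, complete_space}"
  assumes orth: "\<And>i j. i \<in> I \<Longrightarrow> j \<in> I \<Longrightarrow> i \<noteq> j \<Longrightarrow> inner (f i) (f j) = 0"
    and bound: "\<And>F. finite F \<Longrightarrow> F \<subseteq> I \<Longrightarrow> (norm (sum f F))\<^sup>2 \<le> C"
  shows "f summable_on I"
proof -
  let ?g = "\<lambda>i. (norm (f i))\<^sup>2"
  have pyth: "(norm (sum f F))\<^sup>2 = sum ?g F" if "finite F" "F \<subseteq> I" for F
    using that orth by (intro norm_sum_Pythagorean) (auto simp: pairwise_def orthogonal_def)
  have g: "?g summable_on I"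
    using bound pyth by (intro nonneg_bdd_above_summable_on bdd_aboveI2[of _ _ C]) auto
  define L where "L = infsum ?g I"
  have gL: "sum ?g F \<le> L" if "finite F" "F \<subseteq> I" for F
    unfolding L_def using that by (intro finite_sum_le_infsum g) auto
  have "\<exists>P. eventually P (finite_subsets_at_top I) \<and> (\<forall>F F'. P F \<and> P F' \<longrightarrow> dist (sum f F) (sum f F') < e)"
    if "e > 0" for e
  proof -
    define P where "P F \<longleftrightarrow> (finite F \<and> F \<subseteq> I) \<and> L - (e / 2)\<^sup>2 < sum ?g F" for F
    have "(sum ?g \<longlongrightarrow> L) (finite_subsets_at_top I)"
      using has_sum_infsum[OF g] by (simp add: has_sum_def L_def)
    then have "\<forall>\<^sub>F F in finite_subsets_at_top I. L - (e / 2)\<^sup>2 < sum ?g F"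
      using \<open>e > 0\<close> by (intro order_tendstoD) auto
    moreover have "\<forall>\<^sub>F F in finite_subsets_at_top I. finite F \<and> F \<subseteq> I"
      by (rule eventually_finite_subsets_at_top_weakI) simp
    ultimately have evP: "eventually P (finite_subsets_at_top I)"
      unfolding P_def by eventually_elim simp
    have close: "norm (sum f G - sum f F) < e / 2" if "P F" "finite G" "G \<subseteq> I" "F \<subseteq> G" for F G
    proof -
      have "sum f G - sum f F = sum f (G - F)"
        using that by (simp add: sum_diff)
      then have "(norm (sum f G - sum f F))\<^sup>2 = sum ?g (G - F)"
        using pyth[of "G - F"] that by auto
      also have "\<dots> = sum ?g G - sum ?g F"
        using that by (simp add: sum_diff)
      also have "\<dots> < (e / 2)\<^sup>2"
        using gL[of G] that by (auto simp: P_def)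
      finally show ?thesis
        by (rule power2_less_imp_less) (use \<open>e > 0\<close> in simp)
    qed
    have "dist (sum f F) (sum f F') < e" if "P F" "P F'" for F F'
    proof (rule dist_triangle_half_r)
      show "dist (sum f (F \<union> F')) (sum f F) < e / 2" "dist (sum f (F \<union> F')) (sum f F') < e / 2"
        using close[of F "F \<union> F'"] close[of F' "F \<union> F'"] that by (auto simp: dist_norm P_def)
    qed
    then show ?thesis
      using evP by blast
  qed
  then have "cauchy_filter (filtermap (sum f) (finite_subsets_at_top I))"
    by (simp add: cauchy_filter_metric_filtermap)
  moreover have "complete (UNIV :: 'a set)"
    by (rule complete_UNIV)
  ultimately obtain l where "(sum f \<longlongrightarrow> l) (finite_subsets_at_top I)"
    using complete_uniform[where S=UNIV] by (force simp add: filterlim_def)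
  then show ?thesis
    by (auto simp: summable_on_def has_sum_def)
qed

lemma norm_sum_coefficients:
  assumes "finite F" "F \<subseteq> I" "orthonormal_family I w"
  shows "(norm (\<Sum>i\<in>F. c i *\<^sub>C w i))\<^sup>2 = (\<Sum>i\<in>F. (cmod (c i))\<^sup>2)"
proof -
  have "norm (w i) = 1" if "i \<in> I" for i
  proof -
    have "complex_of_real ((norm (w i))\<^sup>2) = 1"
      using assms(3) that cinner_self[of "w i"] by (simp add: orthonormal_family_def)
    then have "(norm (w i))\<^sup>2 = 1"
      by (simp only: of_real_eq_1_iff)
    then show ?thesis
      using norm_ge_zero[of "w i"] by (simp add: power2_eq_1_iff)
  qed
  then have "(norm (c i *\<^sub>C w i))\<^sup>2 = (cmod (c i))\<^sup>2" if "i \<in> F" for i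
    using that assms(2) by (auto simp: norm_scaleC)
  then show ?thesis
    using assms
    by (subst norm_sum_Pythagorean)
       (auto simp: pairwise_def orthogonal_def inner_eq_Re_cinner cinner_scaleC_left
         cinner_scaleC_right orthonormal_family_def subset_iff)
qed

text \<open>The partial isometry that maps \<open>u i\<close> to \<open>v i\<close> and vanishes on the orthogonal complement
  of the family \<open>u\<close>.\<close>

definition transfer_op :: "'i set \<Rightarrow> ('i \<Rightarrow> 'a::complex_hilbert) \<Rightarrow> ('i \<Rightarrow> 'a) \<Rightarrow> ('a \<Rightarrow>\<^sub>L 'a)" where
  "transfer_op I u v = Blinfun (\<lambda>x. \<Sum>\<^sub>\<infinity>i\<in>I. cinner x (u i) *\<^sub>C v i)"

context
  fixes I :: "'i set" and u v :: "'i \<Rightarrow> 'a::complex_hilbert"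
  assumes u: "orthonormal_family I u" and v: "orthonormal_family I v"
begin

text \<open>Bessel's inequality: \<open>x - y\<close> is orthogonal to the partial sum \<open>y\<close> of the expansion of \<open>x\<close>
  along \<open>u\<close>, and replacing \<open>u\<close> by \<open>v\<close> does not change the norm of \<open>y\<close>.\<close>

lemma norm_partial_transfer_le:
  assumes F: "finite F" "F \<subseteq> I"
  shows "norm (\<Sum>i\<in>F. cinner x (u i) *\<^sub>C v i) \<le> norm x"
proof -
  define y where "y = (\<Sum>i\<in>F. cinner x (u i) *\<^sub>C u i)"
  have ny: "(norm y)\<^sup>2 = (\<Sum>i\<in>F. (cmod (cinner x (u i)))\<^sup>2)"
    unfolding y_def by (rule norm_sum_coefficients[OF F u])
  have "cinner x y = (\<Sum>i\<in>F. cnj (cinner x (u i)) * cinner x (u i))"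
    unfolding y_def linear_sum[OF bounded_linear.linear[OF bounded_linear_cinner_right]]
    by (simp add: cinner_scaleC_right)
  then have "inner x y = (norm y)\<^sup>2"
    unfolding ny by (simp add: inner_eq_Re_cinner cmod_power2) (simp add: power2_eq_square)
  then have "norm y * norm y \<le> norm x * norm y"
    using norm_cauchy_schwarz[of x y] by (simp add: power2_eq_square)
  then have "norm y \<le> norm x"
    by (cases "y = 0") auto
  moreover have "(norm (\<Sum>i\<in>F. cinner x (u i) *\<^sub>C v i))\<^sup>2 = (norm y)\<^sup>2"
    unfolding ny by (rule norm_sum_coefficients[OF F v])
  ultimately show ?thesis
    by simp
qed

lemma transfer_summable: "(\<lambda>i. cinner x (u i) *\<^sub>C v i) summable_on I"
proof (rule orthogonal_summable_on)
  show "inner (cinner x (u i) *\<^sub>C v i) (cinner x (u j) *\<^sub>C v j) = 0"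
    if "i \<in> I" "j \<in> I" "i \<noteq> j" for i j
    using v that by (simp add: inner_eq_Re_cinner cinner_scaleC_left cinner_scaleC_right
        orthonormal_family_def)
  show "(norm (\<Sum>i\<in>F. cinner x (u i) *\<^sub>C v i))\<^sup>2 \<le> (norm x)\<^sup>2" if "finite F" "F \<subseteq> I" for F
    using norm_partial_transfer_le[OF that] by (simp add: power_mono)
qed

lemma has_sum_transfer_op:
  "((\<lambda>i. cinner x (u i) *\<^sub>C v i) has_sum transfer_op I u v x) I"
proof -
  let ?T = "\<lambda>x. \<Sum>\<^sub>\<infinity>i\<in>I. cinner x (u i) *\<^sub>C v i"
  have sums: "((\<lambda>i. cinner x (u i) *\<^sub>C v i) has_sum ?T x) I" for x
    using transfer_summable by (rule has_sum_infsum)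
  have "bounded_linear ?T"
  proof (rule bounded_linear_intro[where K = 1])
    show "?T (x + y) = ?T x + ?T y" for x y
      using has_sum_add[OF sums[of x] sums[of y]]
      by (intro infsumI) (simp add: cinner_add_left scaleC_add_left)
    show "?T (r *\<^sub>R x) = r *\<^sub>R ?T x" for r x
      using has_sum_scaleR[OF sums[of x], of r]
      by (intro infsumI) (simp add: scaleC_of_real[symmetric] cinner_scaleC_left scaleC_scaleC)
    show "norm (?T x) \<le> norm x * 1" for x
    proof -
      have lim: "((\<lambda>F. norm (\<Sum>i\<in>F. cinner x (u i) *\<^sub>C v i)) \<longlongrightarrow> norm (?T x)) (finite_subsets_at_top I)"
        using sums[of x] unfolding has_sum_def by (rule tendsto_norm)
      have "norm (?T x) \<le> norm x"
        using norm_partial_transfer_le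
        by (intro tendsto_upperbound[OF lim] eventually_finite_subsets_at_top_weakI) auto
      then show ?thesis
        by simp
    qed
  qed
  then have "transfer_op I u v x = ?T x"
    by (simp add: transfer_op_def bounded_linear_Blinfun_apply)
  then show ?thesis
    using sums by simp
qed

lemma clinear_transfer_op: "clinear_op (transfer_op I u v)"
  unfolding clinear_op_def
proof (intro allI)
  fix c x
  show "transfer_op I u v (c *\<^sub>C x) = c *\<^sub>C transfer_op I u v x"
    using has_sum_bounded_linear[OF bounded_linear_scaleC has_sum_transfer_op[of x], of c]
    by (intro has_sum_unique[OF has_sum_transfer_op]) (simp add: cinner_scaleC_left scaleC_scaleC)
qed

lemma has_sum_cinner_transfer_op:
  "((\<lambda>i. cinner x (u i) * cinner (v i) y) has_sum cinner (transfer_op I u v x) y) I"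
  using has_sum_bounded_linear[OF bounded_linear_cinner_left has_sum_transfer_op[of x], of y]
  by (simp add: cinner_scaleC_left)

lemma cinner_transfer_op:
  assumes "j \<in> I"
  shows "cinner (transfer_op I u v x) (v j) = cinner x (u j)"
proof (rule has_sum_unique[OF has_sum_cinner_transfer_op])
  show "((\<lambda>i. cinner x (u i) * cinner (v i) (v j)) has_sum cinner x (u j)) I"
    using assms v by (intro has_sum_finite_neutralI[of "{j}"]) (auto simp: orthonormal_family_def)
qed

lemma cinner_transfer_op_orthogonal:
  assumes "\<And>i. i \<in> I \<Longrightarrow> cinner (v i) y = 0"
  shows "cinner (transfer_op I u v x) y = 0"
  by (rule has_sum_unique[OF has_sum_cinner_transfer_op]) (simp add: assms has_sum_0)

end

lemma inner_transfer_op: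
  assumes u: "orthonormal_family I u" and v: "orthonormal_family I v"
  shows "inner (transfer_op I u v x) y = inner x (transfer_op I v u y)"
proof -
  have "((\<lambda>i. cnj (cinner y (v i) * cinner (u i) x)) has_sum cnj (cinner (transfer_op I v u y) x)) I"
    by (rule has_sum_bounded_linear[OF bounded_linear_cnj has_sum_cinner_transfer_op[OF v u]])
  then have "((\<lambda>i. cinner x (u i) * cinner (v i) y) has_sum cinner x (transfer_op I v u y)) I"
    by (simp add: cinner_commute[symmetric] mult.commute)
  then have "cinner (transfer_op I u v x) y = cinner x (transfer_op I v u y)"
    by (rule has_sum_unique[OF has_sum_cinner_transfer_op[OF u v]])
  then show ?thesis
    by (simp add: inner_eq_Re_cinner)
qed

lemma transfer_op_cong:
  assumes "\<And>i. i \<in> I \<Longrightarrow> cinner x (u i) = cinner y (w i)"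
    and "orthonormal_family I u" "orthonormal_family I w" "orthonormal_family I v"
  shows "transfer_op I u v x = transfer_op I w v y"
proof (rule has_sum_unique[OF has_sum_transfer_op])
  show "((\<lambda>i. cinner x (u i) *\<^sub>C v i) has_sum transfer_op I w v y) I"
    using has_sum_transfer_op[of I w v y] assms by (simp cong: has_sum_cong)
qed (use assms in auto)

lemma transfer_op_eq_0:
  assumes "\<And>i. i \<in> I \<Longrightarrow> cinner x (u i) = 0"
    and "orthonormal_family I u" "orthonormal_family I v"
  shows "transfer_op I u v x = 0"
proof (rule has_sum_unique[OF has_sum_transfer_op])
  show "((\<lambda>i. cinner x (u i) *\<^sub>C v i) has_sum 0) I"
    by (rule has_sum_0) (simp add: assms(1) complex_vector.scale_zero_left)
qed (use assms in auto)

text \<open>In a maximal orthonormal set the expansion of \<open>x\<close> leaves no remainder, since a nonzero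
  remainder could be normalized and added to the set.\<close>

lemma exists_orthonormal_basis:
  obtains E :: "'a::complex_hilbert set"
  where "orthonormal_family E (\<lambda>e. e)" "\<And>x. transfer_op E (\<lambda>e. e) (\<lambda>e. e) x = x"
proof -
  let ?S = "{E :: 'a set. orthonormal_family E (\<lambda>e. e)}"
  have "\<exists>M\<in>?S. \<forall>X\<in>?S. M \<subseteq> X \<longrightarrow> X = M"
  proof (rule subset_Zorn')
    fix C assume C: "subset.chain ?S C"
    have "cinner x y = (if x = y then 1 else 0)" if xy: "x \<in> \<Union>C" "y \<in> \<Union>C" for x y
    proof -
      obtain X Y where XY: "X \<in> C" "x \<in> X" "Y \<in> C" "y \<in> Y"
        using xy by blast
      then have "X \<subseteq> Y \<or> Y \<subseteq> X"
        using C unfolding subset_chain_def by blast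
      then obtain Z where Z: "Z \<in> C" "x \<in> Z" "y \<in> Z"
        using XY by blast
      then have "orthonormal_family Z (\<lambda>e. e)"
        using C unfolding subset_chain_def by blast
      then show ?thesis
        using Z by (simp add: orthonormal_family_def)
    qed
    then show "\<Union>C \<in> ?S"
      by (simp add: orthonormal_family_def)
  qed
  then obtain E :: "'a set" where E: "orthonormal_family E (\<lambda>e. e)"
    and max: "\<And>X. orthonormal_family X (\<lambda>e. e) \<Longrightarrow> E \<subseteq> X \<Longrightarrow> X = E"
    by blast
  have "transfer_op E (\<lambda>e. e) (\<lambda>e. e) x = x" for x
  proof (rule ccontr)
    assume ne: "transfer_op E (\<lambda>e. e) (\<lambda>e. e) x \<noteq> x"
    define d where "d = x - transfer_op E (\<lambda>e. e) (\<lambda>e. e) x"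
    have d0: "d \<noteq> 0"
      using ne by (simp add: d_def)
    have dE: "cinner d e = 0" if "e \<in> E" for e
      using cinner_transfer_op[OF E E that, of x] by (simp add: d_def cinner_diff_left)
    have Ed: "cinner e d = 0" if "e \<in> E" for e
      using dE[OF that] cinner_commute[of e d] by simp
    define w where "w = complex_of_real (1 / norm d) *\<^sub>C d"
    have "norm w = 1"
      using d0 by (simp add: w_def norm_scaleC norm_divide)
    then have ww: "cinner w w = 1"
      by (simp add: cinner_self)
    have wE: "cinner w e = 0" "cinner e w = 0" if "e \<in> E" for e
      using dE[OF that] Ed[OF that] by (simp_all add: w_def cinner_scaleC_left cinner_scaleC_right)
    have wnot: "w \<notin> E"
      using wE[of w] ww by auto
    have "orthonormal_family (insert w E) (\<lambda>e. e)"
      using E wE ww wnot by (auto simp: orthonormal_family_def)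
    then show False
      using max[of "insert w E"] wnot by blast
  qed
  then show ?thesis
    using that E by blast
qed

lemma infinite_orthonormal_basis:
  fixes H :: "'a::complex_hilbert itself" and E :: "'a set"
  assumes inf: "infinite_dimensional H"
    and E: "orthonormal_family E (\<lambda>e. e)" "\<And>x. transfer_op E (\<lambda>e. e) (\<lambda>e. e) x = x"
  shows "infinite E"
proof
  assume fin: "finite E"
  have "x \<in> module.span scaleC E" for x
  proof -
    have "x = (\<Sum>e\<in>E. cinner x e *\<^sub>C e)"
      using has_sum_unique[OF has_sum_transfer_op[OF E(1) E(1), of x] has_sum_finite[OF fin]] E(2)[of x]
      by simp
    also have "\<dots> \<in> module.span scaleC E"
      by (intro complex_vector.span_sum complex_vector.span_scale complex_vector.span_base)
    finally show ?thesis .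
  qed
  then show False
    using inf fin unfolding infinite_dimensional_def by blast
qed

text \<open>An infinite orthonormal basis \<open>E\<close> is equinumerous with \<open>E \<times> E\<close>, so the space contains
  infinitely many mutually orthogonal copies of itself; \<open>V i\<close> is the isometry onto the \<open>i\<close>-th copy and \<open>V' i\<close>
  its adjoint.\<close>

lemma exists_orthogonal_isometries:
  fixes H :: "'a::complex_hilbert itself"
  assumes inf: "infinite_dimensional H"
  obtains V V' :: "nat \<Rightarrow> 'a \<Rightarrow>\<^sub>L 'a"
  where "\<And>i. clinear_op (V i)" "\<And>i. clinear_op (V' i)"
    "\<And>i x y. inner (V i x) y = inner x (V' i y)"
    "\<And>i j x. V' i (V j x) = (if i = j then x else 0)"
proof -
  obtain E :: "'a set" where E: "orthonormal_family E (\<lambda>e. e)"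
    and basis: "\<And>x. transfer_op E (\<lambda>e. e) (\<lambda>e. e) x = x"
    using exists_orthonormal_basis by blast
  have infE: "infinite E"
    by (rule infinite_orthonormal_basis[OF inf E basis])
  then obtain g where g: "bij_betw g (E \<times> E) E"
    using card_of_Times_same_infinite card_of_ordIso by blast
  obtain k :: "nat \<Rightarrow> 'a" where k: "inj k" "range k \<subseteq> E"
    using infinite_countable_subset[OF infE] by blast
  define p where "p n e = g (k n, e)" for n e
  have p_eq: "p m e = p n e' \<longleftrightarrow> m = n \<and> e = e'" if "e \<in> E" "e' \<in> E" for m n e e'
    using that k inj_on_eq_iff[OF bij_betw_imp_inj_on[OF g], of "(k m, e)" "(k n, e')"]
    by (auto simp: p_def inj_eq)
  have pE: "p n e \<in> E" if "e \<in> E" for n e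
    using that k bij_betw_imp_surj_on[OF g] by (force simp: p_def)
  have cp: "cinner (p m e) (p n e') = (if m = n \<and> e = e' then 1 else 0)"
    if "e \<in> E" "e' \<in> E" for m n e e'
    using E pE[OF that(1)] pE[OF that(2)] p_eq[OF that] by (simp add: orthonormal_family_def)
  have p: "orthonormal_family E (p n)" for n
    by (simp add: orthonormal_family_def cp)
  define V where "V n = transfer_op E (\<lambda>e. e) (p n)" for n
  define V' where "V' n = transfer_op E (p n) (\<lambda>e. e)" for n
  show ?thesis
  proof
    show "clinear_op (V n)" "clinear_op (V' n)" for n
      by (simp_all add: V_def V'_def clinear_transfer_op E p)
    show "inner (V n x) y = inner x (V' n y)" for n x y
      unfolding V_def V'_def by (rule inner_transfer_op[OF E p])
    show "V' m (V n x) = (if m = n then x else 0)" for m n x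
    proof (cases "m = n")
      case True
      have "V' n (V n x) = transfer_op E (\<lambda>e. e) (\<lambda>e. e) x"
        unfolding V_def V'_def
        by (rule transfer_op_cong) (simp_all add: cinner_transfer_op E p)
      then show ?thesis
        using True basis by simp
    next
      case False
      have "V' m (V n x) = 0"
        unfolding V_def V'_def
        by (rule transfer_op_eq_0) (use False in \<open>simp_all add: cinner_transfer_op_orthogonal E p cp\<close>)
      then show ?thesis
        using False by simp
    qed
  qed
qed

section \<open>Jensen's operator inequality\<close>

lemma operator_convexD:
  fixes H :: "'a::complex_hilbert itself" and A B :: "'a \<Rightarrow>\<^sub>L 'a"
  assumes "operator_convex H I f" "0 \<le> c" "c \<le> 1"
    and "selfadjoint_op A" "real_spectrum A \<subseteq> I" "selfadjoint_op B" "real_spectrum B \<subseteq> I"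
  shows "cfc f (c *\<^sub>R A + (1 - c) *\<^sub>R B) \<preceq> c *\<^sub>R cfc f A + (1 - c) *\<^sub>R cfc f B"
  using assms unfolding operator_convex_def
  by (simp add: spectrum_subset_iff)

text \<open>Let \<open>P = W W'\<close> be the range projection of the isometry \<open>W\<close> and \<open>U = 2 P - 1\<close>, a self-adjoint
  unitary. The average \<open>Y\<close> of \<open>X\<close> and \<open>U X U\<close> is the pinching \<open>P X P + (1 - P) X (1 - P)\<close>, hence
  \<open>Y W = W (W' X W)\<close>; convexity at \<open>c = 1/2\<close>, tested on the range of \<open>W\<close>, where \<open>U\<close> is the
  identity, gives the claim.\<close>

lemma operator_convex_compression:
  fixes H :: "'a::complex_hilbert itself" and X W W' :: "'a \<Rightarrow>\<^sub>L 'a"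
  assumes conv: "operator_convex H {0..} f" and X: "positive_op X"
    and W: "clinear_op W" "clinear_op W'" "\<And>x y. inner (W x) y = inner x (W' y)"
    and iso: "\<And>x. W' (W x) = x"
  shows "inner (cfc f (W' o\<^sub>L X o\<^sub>L W) x) x \<le> inner (cfc f X (W x)) (W x)"
proof -
  have f: "continuous_on {0..} f"
    using conv by (simp add: operator_convex_def)
  define Z where "Z = W' o\<^sub>L X o\<^sub>L W"
  have Z: "positive_op Z"
    unfolding Z_def by (rule positive_op_conjugate[OF X W])
  define U where "U = 2 *\<^sub>R (W o\<^sub>L W') - id_blinfun"
  have Ux: "U y = 2 *\<^sub>R W (W' y) - y" for y
    by (simp add: U_def blinfun.diff_left blinfun.scaleR_left)
  have UU: "U (U y) = y" for y
    by (simp add: Ux blinfun.diff_right blinfun.scaleR_right blinfun.add_right iso scaleR_2)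
  have UW: "U (W y) = W y" for y
    by (simp add: Ux iso scaleR_2)
  have Uadj: "inner (U y) z = inner y (U z)" for y z
    by (simp add: Ux inner_diff_left inner_diff_right W(3)) (metis W(3) inner_commute)
  have Ulin: "clinear_op U"
    by (simp add: U_def W)
  define X2 where "X2 = U o\<^sub>L X o\<^sub>L U"
  have X2: "positive_op X2"
    unfolding X2_def by (rule positive_op_conjugate[OF X Ulin Ulin Uadj])
  define Y where "Y = (1/2) *\<^sub>R X + (1 - 1/2) *\<^sub>R X2"
  have Y: "positive_op Y"
    unfolding Y_def by (intro positive_op_add positive_op_scaleR X X2) auto
  have YW: "Y (W y) = W (Z y)" for y
    by (simp add: Y_def X2_def Z_def blinfun.add_left blinfun.scaleR_left UW)
       (simp add: Ux algebra_simps)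
  have fY: "cfc f Y (W y) = W (cfc f Z y)" for y
    by (rule cfc_intertwine[OF _ _ YW f])
       (use Y Z in \<open>simp_all only: positive_op_selfadjoint positive_op_spectrum\<close>)
  have X2U: "X2 (U y) = U (X y)" for y
    by (simp add: X2_def UU)
  have fX2: "cfc f X2 (U y) = U (cfc f X y)" for y
    by (rule cfc_intertwine[OF _ _ X2U f])
       (use X X2 in \<open>simp_all only: positive_op_selfadjoint positive_op_spectrum\<close>)
  have "cfc f Y \<preceq> (1/2) *\<^sub>R cfc f X + (1 - 1/2) *\<^sub>R cfc f X2"
    unfolding Y_def
    by (rule operator_convexD[OF conv _ _ positive_op_selfadjoint[OF X] positive_op_spectrum[OF X]
          positive_op_selfadjoint[OF X2] positive_op_spectrum[OF X2]]) simp_all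
  then have "inner (cfc f Y (W x)) (W x)
      \<le> inner (cfc f X (W x)) (W x) / 2 + inner (cfc f X2 (W x)) (W x) / 2"
    by (simp add: op_le_iff blinfun.add_left blinfun.scaleR_left inner_add_left)
  also have "inner (cfc f X2 (W x)) (W x) = inner (cfc f X (W x)) (W x)"
    using fX2[of "W x"] by (simp add: UW Uadj)
  finally show ?thesis
    by (simp add: fY W(3) iso Z_def)
qed

text \<open>Three orthogonal copies \<open>V 0\<close>, \<open>V 1\<close>, \<open>V 2\<close> of the space turn the contractive column
  \<open>(T1, T2)\<close> into the single isometry \<open>W = V 0 T1 + V 1 T2 + V 2 D\<close>, where
  \<open>D = (1 - T1' T1 - T2' T2)^(1/2)\<close> is the defect operator, and \<open>(X1, X2)\<close>
  into \<open>X = V 0 X1 V' 0 + V 1 X2 V' 1\<close>. As \<open>X\<close> vanishes on the range of \<open>V 2\<close>, the function \<open>f\<close>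
  contributes there only \<open>f 0\<close> times the square of the norm of \<open>D x\<close>.\<close>

lemma operator_convex_jensen:
  fixes H :: "'a::complex_hilbert itself" and X1 X2 T1 T2 T1' T2' :: "'a \<Rightarrow>\<^sub>L 'a"
  assumes inf: "infinite_dimensional H"
    and conv: "operator_convex H {0..} f" and f0: "f 0 \<le> 0"
    and X: "positive_op X1" "positive_op X2"
    and T1: "clinear_op T1" "clinear_op T1'" "\<And>x y. inner (T1 x) y = inner x (T1' y)"
    and T2: "clinear_op T2" "clinear_op T2'" "\<And>x y. inner (T2 x) y = inner x (T2' y)"
    and contr: "\<And>x. (norm (T1 x))\<^sup>2 + (norm (T2 x))\<^sup>2 \<le> (norm x)\<^sup>2"
  shows "inner (cfc f ((T1' o\<^sub>L X1 o\<^sub>L T1) + (T2' o\<^sub>L X2 o\<^sub>L T2)) x) x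
     \<le> inner (cfc f X1 (T1 x)) (T1 x) + inner (cfc f X2 (T2 x)) (T2 x)"
proof -
  have f: "continuous_on {0..} f"
    using conv by (simp add: operator_convex_def)
  obtain V V' :: "nat \<Rightarrow> 'a \<Rightarrow>\<^sub>L 'a" where V: "\<And>i. clinear_op (V i)" "\<And>i. clinear_op (V' i)"
      "\<And>i x y. inner (V i x) y = inner x (V' i y)"
    and VV: "\<And>i j x. V' i (V j x) = (if i = j then x else 0)"
    using exists_orthogonal_isometries[OF inf] by blast
  define R where "R = id_blinfun - (T1' o\<^sub>L T1) - (T2' o\<^sub>L T2)"
  have "selfadjoint_op (T1' o\<^sub>L T1)" "selfadjoint_op (T2' o\<^sub>L T2)"
    using selfadjoint_op_conjugate[OF selfadjoint_op_id T1] selfadjoint_op_conjugate[OF selfadjoint_op_id T2]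
    by (simp_all add: compose_id_blinfun)
  then have Rsa: "selfadjoint_op R"
    by (simp add: R_def)
  have Rx: "R y = y - T1' (T1 y) - T2' (T2 y)" for y
    by (simp add: R_def blinfun.diff_left)
  have "inner (T1' (T1 y)) y = (norm (T1 y))\<^sup>2" "inner (T2' (T2 y)) y = (norm (T2 y))\<^sup>2" for y
    using T1(3)[of y "T1 y"] T2(3)[of y "T2 y"] by (simp_all add: power2_norm_eq_inner inner_commute)
  then have R: "positive_op R"
    using Rsa contr by (simp add: positive_op_iff Rx inner_diff_left inner_add_left power2_norm_eq_inner
        diff_diff_eq)
  define D where "D = cfc sqrt R"
  have sq: "continuous_on (real_spectrum R) sqrt"
    by (intro continuous_intros)
  have Dsa: "selfadjoint_op D"
    unfolding D_def by (rule selfadjoint_cfc[OF Rsa sq])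
  have "D o\<^sub>L D = cfc (\<lambda>t. sqrt t * sqrt t) R"
    unfolding D_def by (rule cfc_mult[OF Rsa sq sq, symmetric])
  also have "\<dots> = R"
    using positive_op_spectrum[OF R] by (intro cfc_ident[OF Rsa]) auto
  finally have DD: "D (D y) = y - T1' (T1 y) - T2' (T2 y)" for y
    by (metis Rx blinfun_apply_blinfun_compose)
  define W where "W = (V 0 o\<^sub>L T1) + (V 1 o\<^sub>L T2) + (V 2 o\<^sub>L D)"
  define W' where "W' = (T1' o\<^sub>L V' 0) + (T2' o\<^sub>L V' 1) + (D o\<^sub>L V' 2)"
  define X where "X = (V 0 o\<^sub>L X1 o\<^sub>L V' 0) + (V 1 o\<^sub>L X2 o\<^sub>L V' 1)"
  have Wx: "W y = V 0 (T1 y) + V 1 (T2 y) + V 2 (D y)" for y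
    by (simp add: W_def blinfun.add_left)
  have W'x: "W' y = T1' (V' 0 y) + T2' (V' 1 y) + D (V' 2 y)" for y
    by (simp add: W'_def blinfun.add_left)
  have Xx: "X y = V 0 (X1 (V' 0 y)) + V 1 (X2 (V' 1 y))" for y
    by (simp add: X_def blinfun.add_left)
  have Wlin: "clinear_op W" "clinear_op W'"
    by (simp_all add: W_def W'_def V T1 T2 selfadjoint_clinear[OF Dsa])
  have Wadj: "inner (W y) z = inner y (W' z)" for y z
    by (simp add: Wx W'x inner_add_left inner_add_right V(3) T1(3) T2(3) selfadjoint_inner[OF Dsa])
  have iso: "W' (W y) = y" for y
    by (simp add: Wx W'x blinfun.add_right VV DD)
  have Vadj': "inner (V' i y) z = inner y (V i z)" for i y z
    by (metis V(3) inner_commute)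
  have Xpos: "positive_op X"
    unfolding X_def
    by (intro positive_op_add positive_op_conjugate assms V Vadj')
  have XV: "X (V 0 y) = V 0 (X1 y)" "X (V 1 y) = V 1 (X2 y)" "X (V 2 y) = V 2 ((0 :: 'a \<Rightarrow>\<^sub>L 'a) y)" for y
    by (simp_all add: Xx VV)
  have zero_pos: "positive_op (0 :: 'a \<Rightarrow>\<^sub>L 'a)"
    by (simp add: positive_op_iff)
  have fXV: "cfc f X (V 0 y) = V 0 (cfc f X1 y)" "cfc f X (V 1 y) = V 1 (cfc f X2 y)"
    "cfc f X (V 2 y) = V 2 (cfc f 0 y)" for y
    by (rule cfc_intertwine[OF _ _ XV(1) f] cfc_intertwine[OF _ _ XV(2) f]
          cfc_intertwine[OF _ _ XV(3) f];
        simp only: positive_op_selfadjoint positive_op_spectrum Xpos assms zero_pos)+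
  have "cfc f 0 = f 0 *\<^sub>R (id_blinfun :: 'a \<Rightarrow>\<^sub>L 'a)"
    using cfc_scalar[of f 0] by simp
  then have cfcW: "cfc f X (W x) = V 0 (cfc f X1 (T1 x)) + V 1 (cfc f X2 (T2 x)) + V 2 (f 0 *\<^sub>R D x)"
    by (simp add: Wx blinfun.add_right fXV[unfolded One_nat_def] blinfun.scaleR_left)
  have comp: "W' o\<^sub>L X o\<^sub>L W = (T1' o\<^sub>L X1 o\<^sub>L T1) + (T2' o\<^sub>L X2 o\<^sub>L T2)"
    by (rule blinfun_eqI) (simp add: Wx W'x Xx blinfun.add_right blinfun.add_left VV)
  have "inner (cfc f (W' o\<^sub>L X o\<^sub>L W) x) x \<le> inner (cfc f X (W x)) (W x)"
    by (rule operator_convex_compression[OF conv Xpos Wlin Wadj iso])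
  also have "\<dots> = inner (cfc f X1 (T1 x)) (T1 x) + inner (cfc f X2 (T2 x)) (T2 x)
      + f 0 * (norm (D x))\<^sup>2"
    unfolding cfcW
    by (simp add: Wx inner_add_left inner_add_right V(3) VV power2_norm_eq_inner)
  also have "\<dots> \<le> inner (cfc f X1 (T1 x)) (T1 x) + inner (cfc f X2 (T2 x)) (T2 x)"
    using f0 by (simp add: mult_nonpos_nonneg)
  finally show ?thesis
    by (simp add: comp)
qed

section \<open>Strictly positive operators and their powers\<close>

lemma strictly_positive_selfadjoint: "strictly_positive_op A \<Longrightarrow> selfadjoint_op A"
  by (simp add: strictly_positive_op_def positive_op_iff)

lemma strictly_positive_spectrum: "strictly_positive_op A \<Longrightarrow> real_spectrum A \<subseteq> {0<..}"
  using strictly_positive_op_iff_spectrum strictly_positive_selfadjoint by blast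

lemma strictly_positive_op_iff_coercive:
  fixes A :: "'a::complex_hilbert \<Rightarrow>\<^sub>L 'a"
  assumes A: "selfadjoint_op A"
  shows "strictly_positive_op A \<longleftrightarrow> (\<exists>e>0. \<forall>x. e * (norm x)\<^sup>2 \<le> inner (A x) x)"
proof
  assume sp: "strictly_positive_op A"
  show "\<exists>e>0. \<forall>x. e * (norm x)\<^sup>2 \<le> inner (A x) x"
  proof (cases "\<exists>x::'a. x \<noteq> 0")
    case True
    then obtain m where m: "m \<in> real_spectrum A" "\<And>x. m * (norm x)\<^sup>2 \<le> inner (A x) x"
      using lower_bound_in_real_spectrum[OF A] by blast
    then have "0 < m"
      using strictly_positive_spectrum[OF sp] by auto
    then show ?thesis
      using m(2) by blast
  next
    case False
    then have "\<forall>x. 1 * (norm x)\<^sup>2 \<le> inner (A x) x"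
      by (metis inner_zero_right mult_zero_right norm_zero order_refl zero_power2)
    then show ?thesis
      using zero_less_one by blast
  qed
next
  assume "\<exists>e>0. \<forall>x. e * (norm x)\<^sup>2 \<le> inner (A x) x"
  then obtain e where e: "e > 0" "\<And>x. e * (norm x)\<^sup>2 \<le> inner (A x) x"
    by blast
  have "0 \<le> inner (A x) x" for x
    by (rule order_trans[OF _ e(2)]) (simp add: less_imp_le[OF e(1)])
  then show "strictly_positive_op A"
    using A coercive_invertible[OF A e] by (simp add: strictly_positive_op_def positive_op_iff)
qed

lemma strictly_positive_convex_combination:
  assumes A: "strictly_positive_op A" and B: "strictly_positive_op B" and c: "0 \<le> c" "c \<le> 1"
  shows "strictly_positive_op (c *\<^sub>R A + (1 - c) *\<^sub>R B)"
proof -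
  note sa = strictly_positive_selfadjoint[OF A] strictly_positive_selfadjoint[OF B]
  obtain d where d: "d > 0" "\<And>x. d * (norm x)\<^sup>2 \<le> inner (A x) x"
    using A strictly_positive_op_iff_coercive[OF sa(1)] by blast
  obtain e where e: "e > 0" "\<And>x. e * (norm x)\<^sup>2 \<le> inner (B x) x"
    using B strictly_positive_op_iff_coercive[OF sa(2)] by blast
  have "min d e * (norm x)\<^sup>2 \<le> inner ((c *\<^sub>R A + (1 - c) *\<^sub>R B) x) x" for x
  proof -
    have "min d e * (norm x)\<^sup>2 \<le> inner (A x) x" "min d e * (norm x)\<^sup>2 \<le> inner (B x) x"
      by (rule order_trans[OF _ d(2)] order_trans[OF _ e(2)]; simp add: mult_right_mono)+
    then have "c * (min d e * (norm x)\<^sup>2) + (1 - c) * (min d e * (norm x)\<^sup>2)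
        \<le> c * inner (A x) x + (1 - c) * inner (B x) x"
      using c by (intro add_mono mult_left_mono) auto
    then show ?thesis
      by (simp add: blinfun.add_left blinfun.scaleR_left inner_add_left) (simp add: algebra_simps)
  qed
  then show ?thesis
    using d(1) e(1) sa by (subst strictly_positive_op_iff_coercive) (auto intro!: exI[of _ "min d e"])
qed

text \<open>The inverse of \<open>h(A)\<close> is \<open>(1/h)(A)\<close>.\<close>

lemma strictly_positive_cfc:
  assumes A: "strictly_positive_op A" and h: "continuous_on {0<..} h" "\<And>t. 0 < t \<Longrightarrow> 0 < h t"
  shows "strictly_positive_op (cfc h A)"
proof -
  note sa = strictly_positive_selfadjoint[OF A]
  have sp: "t > 0" if "t \<in> real_spectrum A" for t
    using strictly_positive_spectrum[OF A] that by auto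
  have ch: "continuous_on (real_spectrum A) h"
    using h(1) strictly_positive_spectrum[OF A] by (rule continuous_on_subset)
  have ci: "continuous_on (real_spectrum A) (\<lambda>t. inverse (h t))"
    using h(2)[OF sp] by (intro continuous_on_inverse ch) force
  have one: "cfc g A = id_blinfun" if "\<And>t. t \<in> real_spectrum A \<Longrightarrow> g t = 1" for g
    using cfc_const[OF sa that] by simp
  have "cfc h A o\<^sub>L cfc (\<lambda>t. inverse (h t)) A = id_blinfun"
    unfolding cfc_mult[OF sa ch ci, symmetric] by (rule one) (use h(2)[OF sp] in force)
  moreover have "cfc (\<lambda>t. inverse (h t)) A o\<^sub>L cfc h A = id_blinfun"
    unfolding cfc_mult[OF sa ci ch, symmetric] by (rule one) (use h(2)[OF sp] in force)
  ultimately have "invertible_op (cfc h A)"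
    unfolding invertible_op_def using selfadjoint_clinear[OF selfadjoint_cfc[OF sa ci]] by blast
  moreover have "positive_op (cfc h A)"
    by (rule cfc_positive[OF sa ch]) (use h(2)[OF sp] in force)
  ultimately show ?thesis
    by (simp add: strictly_positive_op_def)
qed

context
  fixes C :: "'a::complex_hilbert \<Rightarrow>\<^sub>L 'a"
  assumes C: "strictly_positive_op C"
begin

lemma continuous_powr_spectrum: "continuous_on (real_spectrum C) (\<lambda>t. t powr r)"
  using strictly_positive_spectrum[OF C] by (intro continuous_intros) auto

lemma selfadjoint_op_powr: "selfadjoint_op (op_powr C r)"
  unfolding op_powr_def
  by (rule selfadjoint_cfc[OF strictly_positive_selfadjoint[OF C] continuous_powr_spectrum])

lemma op_powr_compose: "op_powr C r o\<^sub>L op_powr C s = op_powr C (r + s)"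
  unfolding op_powr_def
    cfc_mult[OF strictly_positive_selfadjoint[OF C] continuous_powr_spectrum continuous_powr_spectrum, symmetric]
    powr_add ..

lemma op_powr_0: "op_powr C 0 = id_blinfun"
proof -
  have "op_powr C 0 = 1 *\<^sub>R id_blinfun"
    unfolding op_powr_def
    by (rule cfc_const[OF strictly_positive_selfadjoint[OF C]])
       (use strictly_positive_spectrum[OF C] in auto)
  then show ?thesis
    by simp
qed

lemma op_powr_1: "op_powr C 1 = C"
  unfolding op_powr_def
  by (rule cfc_ident[OF strictly_positive_selfadjoint[OF C]])
     (use strictly_positive_spectrum[OF C] in auto)

lemma op_powr_half:
  "op_powr C (1/2) (op_powr C (1/2) x) = C x"
  "op_powr C (1/2) (op_powr C (- (1/2)) x) = x"
  "op_powr C (- (1/2)) (op_powr C (1/2) x) = x"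
  using op_powr_compose[of "1/2" "1/2"] op_powr_compose[of "1/2" "- (1/2)"]
    op_powr_compose[of "- (1/2)" "1/2"] op_powr_0 op_powr_1
  by (metis blinfun_apply_blinfun_compose blinfun_apply_id_blinfun id_apply field_sum_of_halves
      add.right_inverse add.left_inverse)+

end

section \<open>Generalized perspectives\<close>

lemma perspective_domain_convex:
  assumes "(A1, B1) \<in> perspective_domain H" "(A2, B2) \<in> perspective_domain H" "0 \<le> c" "c \<le> 1"
  shows "(c *\<^sub>R A1 + (1 - c) *\<^sub>R A2, c *\<^sub>R B1 + (1 - c) *\<^sub>R B2) \<in> perspective_domain H"
  using assms
  by (simp add: perspective_domain_def strictly_positive_convex_combination positive_op_add
      positive_op_scaleR)

lemma jointly_convex_onD:
  assumes "jointly_convex_on D g" "(A1, B1) \<in> D" "(A2, B2) \<in> D" "0 \<le> c" "c \<le> 1"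
  shows "g (c *\<^sub>R A1 + (1 - c) *\<^sub>R A2) (c *\<^sub>R B1 + (1 - c) *\<^sub>R B2)
    \<preceq> c *\<^sub>R g A1 B1 + (1 - c) *\<^sub>R g A2 B2"
proof -
  note * = assms(1)[unfolded jointly_convex_on_def]
  show ?thesis
    using bspec[OF bspec[OF bspec[OF * assms(2), unfolded prod.case] assms(3), unfolded prod.case], of c]
      assms(4,5) by simp
qed

lemma jointly_concave_onD:
  assumes "jointly_concave_on D g" "(A1, B1) \<in> D" "(A2, B2) \<in> D" "0 \<le> c" "c \<le> 1"
  shows "c *\<^sub>R g A1 B1 + (1 - c) *\<^sub>R g A2 B2
    \<preceq> g (c *\<^sub>R A1 + (1 - c) *\<^sub>R A2) (c *\<^sub>R B1 + (1 - c) *\<^sub>R B2)"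
proof -
  note * = assms(1)[unfolded jointly_concave_on_def]
  show ?thesis
    using bspec[OF bspec[OF bspec[OF * assms(2), unfolded prod.case] assms(3), unfolded prod.case], of c]
      assms(4,5) by simp
qed

locale perspective =
  fixes f h :: "real \<Rightarrow> real" and H :: "'a::complex_hilbert itself"
  assumes f_cont: "continuous_on {0..} f"
    and h_cont: "continuous_on {0<..} h"
    and h_pos: "\<And>t. 0 < t \<Longrightarrow> 0 < h t"
begin

abbreviation half :: "('a \<Rightarrow>\<^sub>L 'a) \<Rightarrow> ('a \<Rightarrow>\<^sub>L 'a)" where
  "half A \<equiv> op_powr (cfc h A) (1/2)"

abbreviation inv_half :: "('a \<Rightarrow>\<^sub>L 'a) \<Rightarrow> ('a \<Rightarrow>\<^sub>L 'a)" where
  "inv_half A \<equiv> op_powr (cfc h A) (- (1/2))"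

lemma half:
  fixes A :: "'a \<Rightarrow>\<^sub>L 'a"
  assumes "strictly_positive_op A"
  shows "selfadjoint_op (half A)" "selfadjoint_op (inv_half A)"
    "half A (half A x) = cfc h A x" "half A (inv_half A x) = x" "inv_half A (half A x) = x"
  using assms
  by (simp_all add: selfadjoint_op_powr op_powr_half strictly_positive_cfc h_cont h_pos)

lemma positive_normalized:
  fixes A B :: "'a \<Rightarrow>\<^sub>L 'a"
  assumes "strictly_positive_op A" "positive_op B"
  shows "positive_op (inv_half A o\<^sub>L B o\<^sub>L inv_half A)"
  using half(2)[OF assms(1)]
  by (intro positive_op_conjugate assms selfadjoint_clinear selfadjoint_inner)

lemma continuous_on_positive_spectrum:
  "positive_op B \<Longrightarrow> continuous_on (real_spectrum B) f"
  using f_cont positive_op_spectrum by (rule continuous_on_subset)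

lemma continuous_on_strictly_positive_spectrum:
  "strictly_positive_op A \<Longrightarrow> continuous_on (real_spectrum A) h"
  using h_cont strictly_positive_spectrum by (rule continuous_on_subset)

lemma gen_perspective_apply:
  fixes A B :: "'a \<Rightarrow>\<^sub>L 'a"
  shows "gen_perspective f h A B x = half A (cfc f (inv_half A o\<^sub>L B o\<^sub>L inv_half A) (half A x))"
  by (simp add: gen_perspective_def)

lemma selfadjoint_gen_perspective:
  fixes A B :: "'a \<Rightarrow>\<^sub>L 'a"
  assumes "strictly_positive_op A" "positive_op B"
  shows "selfadjoint_op (gen_perspective f h A B)"
  unfolding gen_perspective_def
proof (rule selfadjoint_op_conjugate)
  have P: "positive_op (inv_half A o\<^sub>L B o\<^sub>L inv_half A)"
    by (rule positive_normalized[OF assms])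
  show "selfadjoint_op (cfc f (inv_half A o\<^sub>L B o\<^sub>L inv_half A))"
    by (rule selfadjoint_cfc[OF positive_op_selfadjoint[OF P] continuous_on_positive_spectrum[OF P]])
qed (simp_all add: half(1)[OF assms(1)] selfadjoint_clinear selfadjoint_inner)

lemma gen_perspective_uminus:
  fixes A B :: "'a \<Rightarrow>\<^sub>L 'a"
  assumes "strictly_positive_op A" "positive_op B"
  shows "gen_perspective (\<lambda>t. - f t) h A B = - gen_perspective f h A B"
proof -
  note P = positive_normalized[OF assms]
  show ?thesis
    unfolding gen_perspective_def
      cfc_uminus[OF positive_op_selfadjoint[OF P] continuous_on_positive_spectrum[OF P]]
    by (rule blinfun_eqI) (simp add: blinfun.minus_left blinfun.minus_right)
qed

lemma jointly_convex_uminus_iff: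
  "jointly_convex_on (perspective_domain H) (gen_perspective (\<lambda>t. - f t) h) \<longleftrightarrow>
   jointly_concave_on (perspective_domain H) (gen_perspective f h)"
proof -
  have neg: "gen_perspective (\<lambda>t. - f t) h A B = - gen_perspective f h A B"
    if "(A, B) \<in> perspective_domain H" for A B
    using that by (simp add: perspective_domain_def gen_perspective_uminus)
  have iff: "gen_perspective (\<lambda>t. - f t) h (c *\<^sub>R A1 + (1 - c) *\<^sub>R A2) (c *\<^sub>R B1 + (1 - c) *\<^sub>R B2)
          \<preceq> c *\<^sub>R gen_perspective (\<lambda>t. - f t) h A1 B1 + (1 - c) *\<^sub>R gen_perspective (\<lambda>t. - f t) h A2 B2
      \<longleftrightarrow> c *\<^sub>R gen_perspective f h A1 B1 + (1 - c) *\<^sub>R gen_perspective f h A2 B2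
          \<preceq> gen_perspective f h (c *\<^sub>R A1 + (1 - c) *\<^sub>R A2) (c *\<^sub>R B1 + (1 - c) *\<^sub>R B2)"
    if D: "(A1, B1) \<in> perspective_domain H" "(A2, B2) \<in> perspective_domain H"
      and c: "0 \<le> c" "c \<le> 1" for A1 B1 A2 B2 c
  proof -
    have "c *\<^sub>R (- S) + (1 - c) *\<^sub>R (- T) = - (c *\<^sub>R S + (1 - c) *\<^sub>R T)" for S T :: "'a \<Rightarrow>\<^sub>L 'a"
      by simp
    then show ?thesis
      by (simp only: neg[OF D(1)] neg[OF D(2)] neg[OF perspective_domain_convex[OF D c]] op_le_uminus_iff)
  qed
  show ?thesis
  proof
    assume "jointly_convex_on (perspective_domain H) (gen_perspective (\<lambda>t. - f t) h)"
    then show "jointly_concave_on (perspective_domain H) (gen_perspective f h)"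
      unfolding jointly_concave_on_def by clarify (rule iff[THEN iffD1], auto dest: jointly_convex_onD)
  next
    assume "jointly_concave_on (perspective_domain H) (gen_perspective f h)"
    then show "jointly_convex_on (perspective_domain H) (gen_perspective (\<lambda>t. - f t) h)"
      unfolding jointly_convex_on_def by clarify (rule iff[THEN iffD2], auto dest: jointly_concave_onD)
  qed
qed

text \<open>With \<open>S = h(c A1 + (1 - c) A2)\<close>, Jensen's inequality is applied to the normalized operators
  \<open>h(Ai)^(-1/2) Bi h(Ai)^(-1/2)\<close> and to the contractions \<open>sqrt ci h(Ai)^(1/2) S^(-1/2)\<close>; that these
  form a contractive column is exactly operator concavity of \<open>h\<close>.\<close>

lemma jointly_convex_gen_perspective:
  assumes inf: "infinite_dimensional H"
    and f: "operator_convex H {0..} f" and h: "operator_concave H {0<..} h" and f0: "f 0 \<le> 0"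
  shows "jointly_convex_on (perspective_domain H) (gen_perspective f h)"
proof -
  have "gen_perspective f h (c *\<^sub>R A1 + (1 - c) *\<^sub>R A2) (c *\<^sub>R B1 + (1 - c) *\<^sub>R B2)
      \<preceq> c *\<^sub>R gen_perspective f h A1 B1 + (1 - c) *\<^sub>R gen_perspective f h A2 B2"
    if A1: "strictly_positive_op A1" and B1: "positive_op B1"
      and A2: "strictly_positive_op A2" and B2: "positive_op B2"
      and c: "0 \<le> c" "c \<le> 1" for A1 B1 A2 B2 :: "'a \<Rightarrow>\<^sub>L 'a" and c
  proof -
    define A where "A = c *\<^sub>R A1 + (1 - c) *\<^sub>R A2"
    define B where "B = c *\<^sub>R B1 + (1 - c) *\<^sub>R B2"
    have A: "strictly_positive_op A"
      unfolding A_def by (rule strictly_positive_convex_combination[OF A1 A2 c])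
    have B: "positive_op B"
      unfolding B_def using c by (intro positive_op_add positive_op_scaleR B1 B2) auto
    have conc: "c * inner (cfc h A1 y) y + (1 - c) * inner (cfc h A2 y) y \<le> inner (cfc h A y) y" for y
    proof -
      have "cfc (\<lambda>t. - h t) A \<preceq> c *\<^sub>R cfc (\<lambda>t. - h t) A1 + (1 - c) *\<^sub>R cfc (\<lambda>t. - h t) A2"
        unfolding A_def
        by (rule operator_convexD[OF h[unfolded operator_concave_def] c
              strictly_positive_selfadjoint[OF A1] strictly_positive_spectrum[OF A1]
              strictly_positive_selfadjoint[OF A2] strictly_positive_spectrum[OF A2]])
      then have "inner (cfc (\<lambda>t. - h t) A y) y
          \<le> c * inner (cfc (\<lambda>t. - h t) A1 y) y + (1 - c) * inner (cfc (\<lambda>t. - h t) A2 y) y"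
        by (simp add: op_le_iff blinfun.add_left blinfun.scaleR_left inner_add_left)
      then show ?thesis
        using A A1 A2
        by (simp add: cfc_uminus strictly_positive_selfadjoint
            continuous_on_strictly_positive_spectrum blinfun.minus_left)
    qed
    let ?S = "half A" and ?M = "inv_half A"
    let ?X1 = "inv_half A1 o\<^sub>L B1 o\<^sub>L inv_half A1" and ?X2 = "inv_half A2 o\<^sub>L B2 o\<^sub>L inv_half A2"
    define T1 where "T1 = sqrt c *\<^sub>R (half A1 o\<^sub>L ?M)"
    define T1' where "T1' = sqrt c *\<^sub>R (?M o\<^sub>L half A1)"
    define T2 where "T2 = sqrt (1 - c) *\<^sub>R (half A2 o\<^sub>L ?M)"
    define T2' where "T2' = sqrt (1 - c) *\<^sub>R (?M o\<^sub>L half A2)"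
    note sym = half(1,2)[OF A, THEN selfadjoint_inner] half(1,2)[OF A1, THEN selfadjoint_inner]
      half(1,2)[OF A2, THEN selfadjoint_inner]
    note lin = half(1,2)[OF A, THEN selfadjoint_clinear] half(1,2)[OF A1, THEN selfadjoint_clinear]
      half(1,2)[OF A2, THEN selfadjoint_clinear]
    have T1x: "T1 y = sqrt c *\<^sub>R half A1 (?M y)" and T1'x: "T1' y = sqrt c *\<^sub>R ?M (half A1 y)"
      and T2x: "T2 y = sqrt (1 - c) *\<^sub>R half A2 (?M y)"
      and T2'x: "T2' y = sqrt (1 - c) *\<^sub>R ?M (half A2 y)" for y
      by (simp_all add: T1_def T1'_def T2_def T2'_def blinfun.scaleR_left)
    have contr: "(norm (T1 y))\<^sup>2 + (norm (T2 y))\<^sup>2 \<le> (norm y)\<^sup>2" for y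
    proof -
      have "(norm (T1 y))\<^sup>2 = c * inner (cfc h A1 (?M y)) (?M y)"
        "(norm (T2 y))\<^sup>2 = (1 - c) * inner (cfc h A2 (?M y)) (?M y)"
        using c by (simp_all add: T1x T2x power_mult_distrib power2_norm_eq_inner sym half(3)[OF A1]
            half(3)[OF A2] inner_commute)
      then have "(norm (T1 y))\<^sup>2 + (norm (T2 y))\<^sup>2 \<le> inner (cfc h A (?M y)) (?M y)"
        using conc[of "?M y"] by simp
      also have "\<dots> = inner (?S (?S (?M y))) (?M y)"
        by (simp only: half(3)[OF A])
      also have "\<dots> = inner (?S (?M y)) (?S (?M y))"
        by (rule sym)
      also have "\<dots> = (norm y)\<^sup>2"
        by (simp add: half(4)[OF A] power2_norm_eq_inner)
      finally show ?thesis .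
    qed
    have normalized: "?M o\<^sub>L B o\<^sub>L ?M = (T1' o\<^sub>L ?X1 o\<^sub>L T1) + (T2' o\<^sub>L ?X2 o\<^sub>L T2)"
      using c by (intro blinfun_eqI)
        (simp add: T1x T1'x T2x T2'x B_def blinfun.add_left blinfun.add_right blinfun.scaleR_left
          blinfun.scaleR_right half(4,5)[OF A1] half(4,5)[OF A2])
    have ineq: "inner (gen_perspective f h A B x) x
        \<le> c * inner (gen_perspective f h A1 B1 x) x + (1 - c) * inner (gen_perspective f h A2 B2 x) x" for x
    proof -
      have "inner (gen_perspective f h A B x) x = inner (cfc f (?M o\<^sub>L B o\<^sub>L ?M) (?S x)) (?S x)"
        by (simp add: gen_perspective_apply sym)
      also have "\<dots> \<le> inner (cfc f ?X1 (T1 (?S x))) (T1 (?S x)) + inner (cfc f ?X2 (T2 (?S x))) (T2 (?S x))"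
        unfolding normalized
      proof (rule operator_convex_jensen[OF inf f f0 positive_normalized[OF A1 B1] positive_normalized[OF A2 B2]
            _ _ _ _ _ _ contr])
        show "clinear_op T1" "clinear_op T1'" "clinear_op T2" "clinear_op T2'"
          by (simp_all add: T1_def T1'_def T2_def T2'_def lin)
        show "inner (T1 u) v = inner u (T1' v)" "inner (T2 u) v = inner u (T2' v)" for u v
          by (simp_all add: T1x T1'x T2x T2'x sym)
      qed
      also have "\<dots> = c * inner (gen_perspective f h A1 B1 x) x
          + (1 - c) * inner (gen_perspective f h A2 B2 x) x"
        using c by (simp add: T1x T2x half(5)[OF A] gen_perspective_apply sym blinfun.scaleR_right
            flip: mult.assoc)
      finally show ?thesis .
    qed
    then show ?thesis
      using selfadjoint_gen_perspective[OF A B] selfadjoint_gen_perspective[OF A1 B1]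
        selfadjoint_gen_perspective[OF A2 B2]
      unfolding A_def[symmetric] B_def[symmetric]
      by (simp add: op_le_iff blinfun.add_left blinfun.scaleR_left inner_add_left)
  qed
  then show ?thesis
    unfolding jointly_convex_on_def perspective_domain_def by auto
qed

lemma strictly_positive_id: "strictly_positive_op (id_blinfun :: 'a \<Rightarrow>\<^sub>L 'a)"
  by (subst strictly_positive_op_iff_coercive)
     (auto simp: power2_norm_eq_inner intro!: exI[of _ 1])

text \<open>At the identity \<open>h(A)\<close> is the scalar \<open>h 1\<close>; scaling the second argument by \<open>h 1\<close> undoes the
  normalization, so that \<open>f\<close> itself can be read off from its perspective.\<close>

lemma gen_perspective_id:
  "gen_perspective f h id_blinfun (h 1 *\<^sub>R B) = h 1 *\<^sub>R cfc f (B :: 'a \<Rightarrow>\<^sub>L 'a)"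
proof -
  have h1: "h 1 > 0"
    by (simp add: h_pos)
  have "cfc h (id_blinfun :: 'a \<Rightarrow>\<^sub>L 'a) = h 1 *\<^sub>R id_blinfun"
    using cfc_scalar[of h 1] by simp
  then have pw: "op_powr (cfc h id_blinfun) r = (h 1 powr r) *\<^sub>R (id_blinfun :: 'a \<Rightarrow>\<^sub>L 'a)" for r
    by (simp add: op_powr_def cfc_scalar)
  have e1: "h 1 powr (1/2) * h 1 powr (1/2) = h 1"
    using h1 by (simp flip: powr_add)
  have e2: "h 1 powr (- (1/2)) * (h 1 * h 1 powr (- (1/2))) = 1"
  proof -
    have "h 1 powr (- (1/2)) * (h 1 powr 1 * h 1 powr (- (1/2))) = h 1 powr 0"
      unfolding powr_add[symmetric] by simp
    then show ?thesis
      using h1 by simp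
  qed
  have "(op_powr (cfc h id_blinfun) (- (1/2)) o\<^sub>L (h 1 *\<^sub>R B) o\<^sub>L op_powr (cfc h id_blinfun) (- (1/2))) = B"
    unfolding pw using e2
    by (intro blinfun_eqI) (simp add: blinfun.scaleR_left blinfun.scaleR_right mult_ac)
  then show ?thesis
    using e1 unfolding gen_perspective_def
    by (intro blinfun_eqI) (simp add: pw blinfun.scaleR_left blinfun.scaleR_right)
qed

lemma operator_convex_of_jointly_convex:
  assumes jc: "jointly_convex_on (perspective_domain H) (gen_perspective f h)"
  shows "operator_convex H {0..} f"
  unfolding operator_convex_def
proof (intro conjI f_cont allI ballI impI)
  fix A1 A2 :: "'a \<Rightarrow>\<^sub>L 'a" and c :: real
  assume c: "c \<in> {0..1}"
    and "selfadjoint_op A1 \<and> spectrum A1 \<subseteq> complex_of_real ` {0..} \<and>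
      selfadjoint_op A2 \<and> spectrum A2 \<subseteq> complex_of_real ` {0..}"
  then have A: "positive_op A1" "positive_op A2"
    using spectrum_subset_iff[of A1] spectrum_subset_iff[of A2]
      positive_op_iff_spectrum[of A1] positive_op_iff_spectrum[of A2] by simp_all
  have h1: "h 1 > 0"
    by (simp add: h_pos)
  have "(id_blinfun, h 1 *\<^sub>R A1) \<in> perspective_domain H" "(id_blinfun, h 1 *\<^sub>R A2) \<in> perspective_domain H"
    using A h1 by (simp_all add: perspective_domain_def strictly_positive_id positive_op_scaleR)
  then have "gen_perspective f h (c *\<^sub>R id_blinfun + (1 - c) *\<^sub>R id_blinfun)
        (c *\<^sub>R (h 1 *\<^sub>R A1) + (1 - c) *\<^sub>R (h 1 *\<^sub>R A2))
      \<preceq> c *\<^sub>R gen_perspective f h id_blinfun (h 1 *\<^sub>R A1)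
        + (1 - c) *\<^sub>R gen_perspective f h id_blinfun (h 1 *\<^sub>R A2)"
    using c by (intro jointly_convex_onD[OF jc]) auto
  moreover have "c *\<^sub>R id_blinfun + (1 - c) *\<^sub>R id_blinfun = (id_blinfun :: 'a \<Rightarrow>\<^sub>L 'a)"
    by (simp flip: scaleR_add_left)
  moreover have "c *\<^sub>R (h 1 *\<^sub>R S) + (1 - c) *\<^sub>R (h 1 *\<^sub>R T) = h 1 *\<^sub>R (c *\<^sub>R S + (1 - c) *\<^sub>R T)"
    for S T :: "'a \<Rightarrow>\<^sub>L 'a"
    by (simp add: scaleR_add_right mult.commute)
  ultimately show "cfc f (c *\<^sub>R A1 + (1 - c) *\<^sub>R A2) \<preceq> c *\<^sub>R cfc f A1 + (1 - c) *\<^sub>R cfc f A2"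
    by (simp only: gen_perspective_id op_le_scaleR_iff[OF h1])
qed

text \<open>At \<open>B = 0\<close> only the scalar \<open>f 0\<close> of \<open>f\<close> survives and the perspective reduces to \<open>f 0\<close>
  times \<open>h(A)\<close>; the sign of \<open>f 0\<close> decides between convexity and concavity of \<open>h\<close>.\<close>

lemma gen_perspective_zero:
  assumes A: "strictly_positive_op (A :: 'a \<Rightarrow>\<^sub>L 'a)"
  shows "gen_perspective f h A 0 = f 0 *\<^sub>R cfc h A"
proof -
  have "cfc f (0 :: 'a \<Rightarrow>\<^sub>L 'a) = f 0 *\<^sub>R id_blinfun"
    using cfc_scalar[of f 0] by simp
  moreover have "inv_half A o\<^sub>L 0 o\<^sub>L inv_half A = 0"
    by (rule blinfun_eqI) simp
  ultimately show ?thesis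
    unfolding gen_perspective_def
    by (intro blinfun_eqI) (simp add: blinfun.scaleR_left blinfun.scaleR_right half(3)[OF A])
qed

lemma jointly_convex_at_zero:
  fixes A1 A2 :: "'a \<Rightarrow>\<^sub>L 'a"
  assumes jc: "jointly_convex_on (perspective_domain H) (gen_perspective f h)"
    and A: "strictly_positive_op A1" "strictly_positive_op A2" and c: "0 \<le> c" "c \<le> 1"
  shows "f 0 *\<^sub>R cfc h (c *\<^sub>R A1 + (1 - c) *\<^sub>R A2) \<preceq> f 0 *\<^sub>R (c *\<^sub>R cfc h A1 + (1 - c) *\<^sub>R cfc h A2)"
proof -
  have "(A1, 0) \<in> perspective_domain H" "(A2, 0) \<in> perspective_domain H"
    using A by (simp_all add: perspective_domain_def positive_op_iff)
  then have "gen_perspective f h (c *\<^sub>R A1 + (1 - c) *\<^sub>R A2) (c *\<^sub>R 0 + (1 - c) *\<^sub>R 0)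
      \<preceq> c *\<^sub>R gen_perspective f h A1 0 + (1 - c) *\<^sub>R gen_perspective f h A2 0"
    using c by (intro jointly_convex_onD[OF jc]) auto
  then show ?thesis
    using A c
    by (simp add: gen_perspective_zero strictly_positive_convex_combination scaleR_add_right mult.commute)
qed

lemma operator_convex_on_strictly_positive:
  assumes "continuous_on {0<..} g"
    and "\<And>(A1 :: 'a \<Rightarrow>\<^sub>L 'a) A2 c. strictly_positive_op A1 \<Longrightarrow> strictly_positive_op A2 \<Longrightarrow> 0 \<le> c \<Longrightarrow> c \<le> 1 \<Longrightarrow>
      cfc g (c *\<^sub>R A1 + (1 - c) *\<^sub>R A2) \<preceq> c *\<^sub>R cfc g A1 + (1 - c) *\<^sub>R cfc g A2"
  shows "operator_convex H {0<..} g"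
  unfolding operator_convex_def
proof (intro conjI assms allI ballI impI)
  fix A1 A2 :: "'a \<Rightarrow>\<^sub>L 'a"
  assume "selfadjoint_op A1 \<and> spectrum A1 \<subseteq> complex_of_real ` {0<..} \<and>
      selfadjoint_op A2 \<and> spectrum A2 \<subseteq> complex_of_real ` {0<..}"
  then show "strictly_positive_op A1" "strictly_positive_op A2"
    using spectrum_subset_iff[of A1] spectrum_subset_iff[of A2]
      strictly_positive_op_iff_spectrum[of A1] strictly_positive_op_iff_spectrum[of A2] by simp_all
qed simp_all

lemma operator_convex_h:
  assumes "jointly_convex_on (perspective_domain H) (gen_perspective f h)" "f 0 > 0"
  shows "operator_convex H {0<..} h"
proof (rule operator_convex_on_strictly_positive[OF h_cont])
  fix A1 A2 :: "'a \<Rightarrow>\<^sub>L 'a" and c :: real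
  assume "strictly_positive_op A1" "strictly_positive_op A2" "0 \<le> c" "c \<le> 1"
  then show "cfc h (c *\<^sub>R A1 + (1 - c) *\<^sub>R A2) \<preceq> c *\<^sub>R cfc h A1 + (1 - c) *\<^sub>R cfc h A2"
    by (rule jointly_convex_at_zero[OF assms(1), unfolded op_le_scaleR_iff[OF assms(2)]])
qed

lemma operator_concave_h:
  assumes jc: "jointly_convex_on (perspective_domain H) (gen_perspective f h)" and f0: "f 0 < 0"
  shows "operator_concave H {0<..} h"
  unfolding operator_concave_def
proof (rule operator_convex_on_strictly_positive)
  show "continuous_on {0<..} (\<lambda>t. - h t)"
    by (intro continuous_intros h_cont)
  fix A1 A2 :: "'a \<Rightarrow>\<^sub>L 'a" and c :: real
  assume A: "strictly_positive_op A1" "strictly_positive_op A2" and c: "0 \<le> c" "c \<le> 1"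
  have neg: "cfc (\<lambda>t. - h t) A = - cfc h A" if "strictly_positive_op A" for A :: "'a \<Rightarrow>\<^sub>L 'a"
    using that by (simp add: cfc_uminus strictly_positive_selfadjoint continuous_on_strictly_positive_spectrum)
  have "(- f 0) *\<^sub>R (- cfc h (c *\<^sub>R A1 + (1 - c) *\<^sub>R A2))
      \<preceq> (- f 0) *\<^sub>R (- (c *\<^sub>R cfc h A1 + (1 - c) *\<^sub>R cfc h A2))"
  proof -
    have "(- f 0) *\<^sub>R (- T) = f 0 *\<^sub>R T" for T :: "'a \<Rightarrow>\<^sub>L 'a"
      by simp
    then show ?thesis
      using jointly_convex_at_zero[OF jc A c] by (simp only:)
  qed
  then have "- cfc h (c *\<^sub>R A1 + (1 - c) *\<^sub>R A2) \<preceq> - (c *\<^sub>R cfc h A1 + (1 - c) *\<^sub>R cfc h A2)"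
    by (subst (asm) op_le_scaleR_iff) (use f0 in simp_all)
  then show "cfc (\<lambda>t. - h t) (c *\<^sub>R A1 + (1 - c) *\<^sub>R A2)
      \<preceq> c *\<^sub>R cfc (\<lambda>t. - h t) A1 + (1 - c) *\<^sub>R cfc (\<lambda>t. - h t) A2"
    using A c by (simp add: neg strictly_positive_convex_combination)
qed

end

section \<open>Joint convexity of generalized perspectives\<close>

theorem theorem1p3:
  fixes f h :: "real \<Rightarrow> real"
    and H :: "'a::complex_hilbert itself"
  assumes inf_dim: "infinite_dimensional H"
    and separable: "separable_space (euclidean :: 'a topology)"
    and f_cont: "continuous_on {0..} f"
    and h_cont: "continuous_on {0<..} h"
    and h_pos: "\<And>t. 0 < t \<Longrightarrow> 0 < h t"
  shows
    "(operator_convex H {0..} f \<and> operator_concave H {0<..} h \<and> f 0 \<le> 0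
        \<longrightarrow> jointly_convex_on (perspective_domain H) (gen_perspective f h)) \<and>
     (operator_concave H {0..} f \<and> operator_concave H {0<..} h \<and> f 0 \<ge> 0
        \<longrightarrow> jointly_concave_on (perspective_domain H) (gen_perspective f h)) \<and>
     (jointly_convex_on (perspective_domain H) (gen_perspective f h) \<longrightarrow> operator_convex H {0..} f) \<and>
     (jointly_concave_on (perspective_domain H) (gen_perspective f h) \<longrightarrow> operator_concave H {0..} f) \<and>
     (f 0 > 0 \<and> jointly_convex_on (perspective_domain H) (gen_perspective f h) \<longrightarrow> operator_convex H {0<..} h) \<and>
     (f 0 > 0 \<and> jointly_concave_on (perspective_domain H) (gen_perspective f h) \<longrightarrow> operator_concave H {0<..} h) \<and>
     (f 0 < 0 \<and> jointly_convex_on (perspective_domain H) (gen_perspective f h) \<longrightarrow> operator_concave H {0<..} h) \<and>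
     (f 0 < 0 \<and> jointly_concave_on (perspective_domain H) (gen_perspective f h) \<longrightarrow> operator_convex H {0<..} h)"
proof -
  interpret pos: perspective f h H
    by unfold_locales (use f_cont h_cont h_pos in auto)
  interpret neg: perspective "\<lambda>t. - f t" h H
    by unfold_locales (use f_cont h_cont h_pos in \<open>auto intro: continuous_intros\<close>)
  show ?thesis
    using pos.jointly_convex_gen_perspective[OF inf_dim] neg.jointly_convex_gen_perspective[OF inf_dim]
      pos.operator_convex_of_jointly_convex neg.operator_convex_of_jointly_convex
      pos.operator_convex_h neg.operator_convex_h pos.operator_concave_h neg.operator_concave_h
    unfolding operator_concave_def[of H "{0..}" f] pos.jointly_convex_uminus_iff
    by auto
qed

end
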